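(* Let $P$ be a poset. Suppose there is a function $w$ defined on $P$ such that: (1) for every $p\in P$, $w(p)$ is a finite set; (2) if $p,q\in P$ are compatible, then they have a common lower bound $r\leq p,q$ with $w(r)=w(p)\cup w(q)$; (3) whenever $\{p_\alpha\colon\alpha\in\omega_1\}$ and $\{q_\alpha\colon\alpha\in\omega_1\}$ are subsets of $P$ such that $\{w(p_\alpha)\colon\alpha\in\omega_1\}$ and $\{w(q_\alpha)\colon\alpha\in\omega_1\}$ are $\Delta$-systems with the same root, there are ordinals $\alpha,\beta\in\omega_1$ such that $p_\alpha$ and $q_\beta$ are compatible. Then $P$ satisfies Y-c.c.
   Context: For a separative poset $P$, $RO(P)$ is its completion; $H_\theta$ ($\theta$ large regular) is the set of sets of hereditary cardinality $<\theta$. $P$ satisfies \emph{Y-c.c.} if for every countable elementary submodel $M\prec H_\theta$ containing $P$ and every $q\in P$ there is a filter $F\in M$ on $RO(P)$ with $\{p\in RO(P)\cap M\colon p\geq q\}\subset F$ ($p\geq q$ means $q$ is stronger). *)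

theory Defs
  imports "HOL-Library.Countable_Set"
begin

unbundle cardinal_syntax

text \<open>
  HOL has no type of all sets, so \<open>H\<^sub>\<theta>\<close> is described up to isomorphism: by Mostowski collapse,
  for regular infinite \<open>\<theta>\<close> the relation \<open>E\<close> on \<open>H\<close> satisfies the predicate below iff \<open>(H, E)\<close> is
  isomorphic to \<open>(H\<^sub>\<theta>, \<in>)\<close>.  The set of all \<open>y\<close> with \<open>(y, x) \<in> E\<^sup>+\<close> is the transitive closure
  of \<open>x\<close>.
\<close>

definition elts :: "'h rel \<Rightarrow> 'h \<Rightarrow> 'h set" where
  "elts E x = {y. (y, x) \<in> E}"

definition is_H_theta :: "'h rel \<Rightarrow> 'h set \<Rightarrow> 'h rel \<Rightarrow> bool" where
  "is_H_theta \<theta> H E \<longleftrightarrow>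
     E \<subseteq> H \<times> H \<and> wf E \<and> inj_on (elts E) H \<and>
     (\<forall>x\<in>H. |{y. (y, x) \<in> E\<^sup>+}| <o \<theta>) \<and>
     (\<forall>X\<subseteq>H. |X| <o \<theta> \<longrightarrow> (\<exists>x\<in>H. elts E x = X))"

definition set_code :: "'h set \<Rightarrow> 'h rel \<Rightarrow> 'h set \<Rightarrow> 'h" where
  "set_code H E X = (THE x. x \<in> H \<and> elts E x = X)"

definition pair_code :: "'h set \<Rightarrow> 'h rel \<Rightarrow> 'h \<Rightarrow> 'h \<Rightarrow> 'h" where
  "pair_code H E x y = set_code H E {set_code H E {x}, set_code H E {x, y}}"

datatype fm = FMem nat nat | FEq nat nat | FNeg fm | FConj fm fm | FEx nat fm

fun sat :: "'h set \<Rightarrow> 'h rel \<Rightarrow> (nat \<Rightarrow> 'h) \<Rightarrow> fm \<Rightarrow> bool" where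
  "sat M E v (FMem i j) \<longleftrightarrow> (v i, v j) \<in> E"
| "sat M E v (FEq i j) \<longleftrightarrow> v i = v j"
| "sat M E v (FNeg \<phi>) \<longleftrightarrow> \<not> sat M E v \<phi>"
| "sat M E v (FConj \<phi> \<psi>) \<longleftrightarrow> sat M E v \<phi> \<and> sat M E v \<psi>"
| "sat M E v (FEx i \<phi>) \<longleftrightarrow> (\<exists>x\<in>M. sat M E (v(i := x)) \<phi>)"

definition elementary_submodel :: "'h set \<Rightarrow> 'h set \<Rightarrow> 'h rel \<Rightarrow> bool" where
  "elementary_submodel M H E \<longleftrightarrow>
     M \<subseteq> H \<and> M \<noteq> {} \<and> (\<forall>\<phi> v. range v \<subseteq> M \<longrightarrow> (sat M E v \<phi> \<longleftrightarrow> sat H E v \<phi>))"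

text \<open>
  A poset is a carrier \<open>P\<close> with a relation \<open>le\<close>; \<open>(p, q) \<in> le\<close> means \<open>p \<le> q\<close>, i.e. \<open>p\<close> is stronger.
  The completion consists of the regular open sets of the topology whose open sets are the downward
  closed ones; its order is inclusion, binary meet is intersection and its zero is the empty set.
\<close>

definition compatible :: "'a set \<Rightarrow> 'a rel \<Rightarrow> 'a \<Rightarrow> 'a \<Rightarrow> bool" where
  "compatible P le p q \<longleftrightarrow> (\<exists>r\<in>P. (r, p) \<in> le \<and> (r, q) \<in> le)"

definition down_closure :: "'a set \<Rightarrow> 'a rel \<Rightarrow> 'a set \<Rightarrow> 'a set" where
  "down_closure P le U = {p \<in> P. \<exists>q\<in>U. (q, p) \<in> le}"

definition down_interior :: "'a set \<Rightarrow> 'a rel \<Rightarrow> 'a set \<Rightarrow> 'a set" where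
  "down_interior P le U = {p \<in> P. \<forall>q\<in>P. (q, p) \<in> le \<longrightarrow> q \<in> U}"

definition RO :: "'a set \<Rightarrow> 'a rel \<Rightarrow> 'a set set" where
  "RO P le = {U. U \<subseteq> P \<and> down_interior P le (down_closure P le U) = U}"

definition RO_embed :: "'a set \<Rightarrow> 'a rel \<Rightarrow> 'a \<Rightarrow> 'a set" where
  "RO_embed P le q = down_interior P le (down_closure P le {p \<in> P. (p, q) \<in> le})"

text \<open>Filters are proper; otherwise \<open>RO P le\<close> itself would always be a filter.\<close>

definition RO_filter :: "'a set \<Rightarrow> 'a rel \<Rightarrow> 'a set set \<Rightarrow> bool" where
  "RO_filter P le F \<longleftrightarrow>
     F \<subseteq> RO P le \<and> F \<noteq> {} \<and> {} \<notin> F \<and>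
     (\<forall>U\<in>F. \<forall>V\<in>RO P le. U \<subseteq> V \<longrightarrow> V \<in> F) \<and>
     (\<forall>U\<in>F. \<forall>V\<in>F. U \<inter> V \<in> F)"

text \<open>
  A map \<open>c\<close> injective on \<open>P\<close> turns the points of \<open>P\<close> into elements of \<open>H\<^sub>\<theta>\<close>.  The poset is then the
  ordered pair of its carrier and its order relation, a subset of \<open>P\<close> is a set of points, and a
  subset of \<open>RO P le\<close> is a set of such sets.
\<close>

definition poset_code :: "'h set \<Rightarrow> 'h rel \<Rightarrow> ('a \<Rightarrow> 'h) \<Rightarrow> 'a set \<Rightarrow> 'a rel \<Rightarrow> 'h" where
  "poset_code H E c P le =
     pair_code H E (set_code H E (c ` P))
       (set_code H E ((\<lambda>(p, q). pair_code H E (c p) (c q)) ` le))"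

definition subset_code :: "'h set \<Rightarrow> 'h rel \<Rightarrow> ('a \<Rightarrow> 'h) \<Rightarrow> 'a set \<Rightarrow> 'h" where
  "subset_code H E c U = set_code H E (c ` U)"

definition family_code :: "'h set \<Rightarrow> 'h rel \<Rightarrow> ('a \<Rightarrow> 'h) \<Rightarrow> 'a set set \<Rightarrow> 'h" where
  "family_code H E c F = set_code H E (subset_code H E c ` F)"

text \<open>
  ``Large'' means that \<open>\<theta>\<close> exceeds \<open>\<omega>\<^sub>1\<close> and the cardinality of the power set of \<open>P\<close>, so that
  \<open>\<omega>\<^sub>1\<close>, \<open>P\<close>, \<open>RO(P)\<close> and all filters on \<open>RO(P)\<close> belong to \<open>H\<^sub>\<theta>\<close>.
\<close>

definition large_regular :: "'h rel \<Rightarrow> 'a set \<Rightarrow> bool" where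
  "large_regular \<theta> P \<longleftrightarrow>
     Card_order \<theta> \<and> regularCard \<theta> \<and> cardSuc natLeq <o \<theta> \<and> |Pow P| <o \<theta>"

text \<open>
  The type argument is the type that carries \<open>H\<^sub>\<theta>\<close>; a statement about all \<open>H\<^sub>\<theta>\<close> leaves it as a type
  variable.  Taking \<open>\<theta>\<close> over the same type is no restriction, since \<open>\<theta>\<close> embeds into \<open>H\<^sub>\<theta>\<close>.
\<close>

definition Ycc :: "'h itself \<Rightarrow> 'a set \<Rightarrow> 'a rel \<Rightarrow> bool" where
  "Ycc T P le \<longleftrightarrow>
     (\<forall>(\<theta> :: 'h rel) H E c.
        large_regular \<theta> P \<and> is_H_theta \<theta> H E \<and> inj_on c P \<and> c ` P \<subseteq> H \<longrightarrow>
        (\<forall>M q. countable M \<and> elementary_submodel M H E \<and> poset_code H E c P le \<in> M \<and> q \<in> P \<longrightarrow>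
          (\<exists>F. RO_filter P le F \<and> family_code H E c F \<in> M \<and>
               {U \<in> RO P le. subset_code H E c U \<in> M \<and> RO_embed P le q \<subseteq> U} \<subseteq> F)))"

definition omega1 :: "nat set set" where
  "omega1 = Field (cardSuc natLeq)"

text \<open>
  Delta-systems are indexed families: the members at distinct indices meet exactly in the root, so a
  repeated member equals the root.
\<close>

definition delta_system :: "'i set \<Rightarrow> ('i \<Rightarrow> 'b set) \<Rightarrow> 'b set \<Rightarrow> bool" where
  "delta_system I A r \<longleftrightarrow> (\<forall>i\<in>I. \<forall>j\<in>I. i \<noteq> j \<longrightarrow> A i \<inter> A j = r)"

inductive_set hereditary :: "'h rel \<Rightarrow> ('h set \<Rightarrow> 'h) \<Rightarrow> 'h set" for \<theta> g where
  "(\<And>y. y \<in> X \<Longrightarrow> y \<in> hereditary \<theta> g) \<Longrightarrow> |X| <o \<theta> \<Longrightarrow> g X \<in> hereditary \<theta> g"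

lemma is_H_theta_hereditary:
  fixes g :: "'h set \<Rightarrow> 'h"
  assumes \<theta>: "Card_order \<theta>" "regularCard \<theta>" "infinite (Field \<theta>)"
    and g: "inj_on g {X. |X| <o \<theta>}"
  defines "H \<equiv> hereditary \<theta> g"
  defines "E \<equiv> {(y, g X) |X y. X \<subseteq> H \<and> |X| <o \<theta> \<and> y \<in> X}"
  shows "is_H_theta \<theta> H E"
proof -
  have elts: "elts E (g X) = X" if "X \<subseteq> H" "|X| <o \<theta>" for X
    using that g unfolding elts_def E_def inj_on_def by blast
  have ex: "\<exists>X\<subseteq>H. |X| <o \<theta> \<and> x = g X" if "x \<in> H" for x
    using that unfolding H_def by (auto elim: hereditary.cases)
  have HI: "g X \<in> H" if "X \<subseteq> H" "|X| <o \<theta>" for X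
    using that unfolding H_def by (auto intro: hereditary.intros)
  have sub: "E \<subseteq> H \<times> H"
    unfolding E_def using HI by auto
  have ind: "Q x" if "x \<in> H" and step: "\<And>X. X \<subseteq> H \<Longrightarrow> |X| <o \<theta> \<Longrightarrow> (\<And>y. y \<in> X \<Longrightarrow> Q y) \<Longrightarrow> Q (g X)" for Q x
    using that(1) unfolding H_def
    by (induction rule: hereditary.induct) (auto intro!: step simp: H_def)
  have wf: "wf E"
  proof (rule wfI[OF sub])
    fix x Q assume *: "\<forall>x. (\<forall>y. (y, x) \<in> E \<longrightarrow> Q y) \<longrightarrow> Q x" and "x \<in> H"
    from this(2) show "Q x"
    proof (rule ind)
      fix X assume X: "X \<subseteq> H" "|X| <o \<theta>" "\<And>y. y \<in> X \<Longrightarrow> Q y"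
      have "\<forall>y. (y, g X) \<in> E \<longrightarrow> Q y" using X elts[of X] unfolding elts_def by auto
      with * show "Q (g X)" by blast
    qed
  qed
  have inj: "inj_on (elts E) H"
    by (rule inj_onI) (metis elts ex)
  have small: "|{y. (y, x) \<in> E\<^sup>+}| <o \<theta>" if "x \<in> H" for x
    using that
  proof (rule ind)
    fix X assume X: "X \<subseteq> H" "|X| <o \<theta>" "\<And>y. y \<in> X \<Longrightarrow> |{z. (z, y) \<in> E\<^sup>+}| <o \<theta>"
    have st: "stable \<theta>" using \<theta> by (simp add: regularCard_stable)
    have one: "|{y} \<union> {z. (z, y) \<in> E\<^sup>+}| <o \<theta>" if "y \<in> X" for y
      using X(3)[OF that] \<theta>
      by (intro card_of_Un_ordLess_infinite_Field)
        (auto simp: Field_card_of card_of_well_order_on card_order_on_well_order_on intro!: finite_ordLess_infinite)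
    have eq: "{z. (z, g X) \<in> E\<^sup>+} = (\<Union>y\<in>X. {y} \<union> {z. (z, y) \<in> E\<^sup>+})"
      using elts[OF X(1,2)] unfolding elts_def
      by (auto elim: tranclE intro: trancl_into_trancl) (erule tranclE, auto)
    have "|SIGMA y:X. {y} \<union> {z. (z, y) \<in> E\<^sup>+}| <o \<theta>"
      by (rule stable_elim[OF st X(2) one])
    then show "|{z. (z, g X) \<in> E\<^sup>+}| <o \<theta>"
      unfolding eq by (rule ordLeq_ordLess_trans[OF card_of_UNION_Sigma])
  qed
  have "\<exists>x\<in>H. elts E x = X" if "X \<subseteq> H" "|X| <o \<theta>" for X
    using HI elts that by blast
  with sub wf inj small show ?thesis unfolding is_H_theta_def by auto
qed

lemma is_H_theta_exists:
  assumes inf: "infinite (UNIV :: 'k set)"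
  shows "\<exists>H (E :: 'k set rel). is_H_theta (cardSuc |UNIV :: 'k set| ) H E"
proof -
  let ?\<theta> = "cardSuc |UNIV :: 'k set|"
  obtain t :: "'k \<times> 'k \<Rightarrow> 'k" where t: "inj t"
    using card_of_Times_same_infinite[OF inf] card_of_ordLeq[of "UNIV \<times> UNIV :: ('k \<times> 'k) set" "UNIV :: 'k set"]
      ordIso_imp_ordLeq by auto
  obtain a b :: 'k where ab: "a \<noteq> b"
    using inf by (metis (full_types) UNIV_eq_I finite.emptyI finite_insert insertCI)
  have "\<exists>k :: 'k set \<Rightarrow> 'k. inj_on k X" if "|X| <o ?\<theta>" for X :: "'k set set"
  proof -
    have "|X| \<le>o |UNIV :: 'k set|"
      using that cardSuc_ordLeq_ordLess[of "|UNIV :: 'k set|" "|X|"] by (simp add: card_of_Card_order)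
    then show ?thesis using card_of_ordLeq[of X "UNIV :: 'k set"] by auto
  qed
  then obtain k where k: "\<And>X :: 'k set set. |X| <o ?\<theta> \<Longrightarrow> inj_on (k X :: 'k set \<Rightarrow> 'k) X" by metis
  define g where "g X = {t (a, t (k X x, k X x)) |x. x \<in> X} \<union> {t (b, t (k X x, j)) |x j. x \<in> X \<and> j \<in> x}" for X
  define d where "d S = {{j. t (b, t (i, j)) \<in> S} |i. t (a, t (i, i)) \<in> S}" for S
  have dg: "d (g X) = X" if "|X| <o ?\<theta>" for X
  proof -
    have A: "t (a, t (i, i)) \<in> g X \<longleftrightarrow> (\<exists>x\<in>X. i = k X x)" for i
      unfolding g_def using ab by (auto simp: inj_eq[OF t])
    have B: "{j. t (b, t (k X x, j)) \<in> g X} = x" if "x \<in> X" for x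
      unfolding g_def using ab that inj_onD[OF k[OF \<open>|X| <o ?\<theta>\<close>]]
      by (auto simp: inj_eq[OF t])
    have "d (g X) = (\<lambda>x. {j. t (b, t (k X x, j)) \<in> g X}) ` X"
      unfolding d_def A by auto
    then show ?thesis using B by simp
  qed
  have g: "inj_on g {X. |X| <o ?\<theta>}"
    by (rule inj_on_inverseI[of _ d]) (simp add: dg)
  have "infinite (Field ?\<theta>)" using card_of_cardSuc_finite[of "UNIV :: 'k set"] inf by simp
  moreover have "regularCard ?\<theta>"
    by (rule infinite_cardSuc_regularCard) (use inf in \<open>simp_all add: Field_card_of card_of_card_order_on\<close>)
  ultimately show ?thesis
    using is_H_theta_hereditary[OF cardSuc_Card_order[OF card_of_Card_order] _ _ g] by blast
qed

text \<open>Every poset has a suitable \<open>H\<^sub>\<theta>\<close> at some type, so \<open>Ycc\<close> is not vacuous there.\<close>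

lemma large_H_theta_exists:
  fixes P :: "'a set"
  shows "\<exists>(\<theta> :: ('a set + nat set) set rel) H E c.
    large_regular \<theta> P \<and> is_H_theta \<theta> H E \<and> inj_on c P \<and> c ` P \<subseteq> H"
proof -
  let ?U = "UNIV :: ('a set + nat set) set"
  let ?\<theta> = "cardSuc |?U|"
  have inf: "infinite ?U"
    by (simp add: finite_Plus_UNIV_iff Finite_Set.finite_set)
  obtain H E where H: "is_H_theta ?\<theta> H E" using is_H_theta_exists[OF inf] by blast
  have co: "Card_order ?\<theta>" by (simp add: cardSuc_Card_order card_of_Card_order)
  have up: "r <o ?\<theta>" if "r \<le>o |?U|" for r :: "'x rel"
    using that cardSuc_greater[OF card_of_Card_order] ordLeq_ordLess_trans by blast
  have "|Pow P| \<le>o |?U|"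
    by (rule card_of_ordLeqI[of Inl]) auto
  then have 1: "|Pow P| <o ?\<theta>" by (rule up)
  have "cardSuc natLeq \<le>o |UNIV :: nat set set|"
    by (metis Card_order_iff_ordLeq_card_of UNIV_I cardSuc_Card_order card_of_mono1 natLeq_Card_order ordLeq_transitive subsetI)
  moreover have "|UNIV :: nat set set| \<le>o |?U|"
    by (rule card_of_ordLeqI[of Inr]) auto
  ultimately have 2: "cardSuc natLeq <o ?\<theta>" using up ordLeq_transitive by blast
  have reg: "regularCard ?\<theta>"
    by (rule infinite_cardSuc_regularCard) (use inf in \<open>simp_all add: Field_card_of card_of_card_order_on\<close>)
  have "?\<theta> \<le>o |H|"
  proof (rule ccontr)
    assume "\<not> ?\<theta> \<le>o |H|"
    then have "|H| <o ?\<theta>"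
      using co not_ordLeq_iff_ordLess[OF card_of_Well_order card_order_on_well_order_on[OF co]] by blast
    then obtain x where "x \<in> H" "elts E x = H" using H unfolding is_H_theta_def by blast
    then have "(x, x) \<in> E" unfolding elts_def by auto
    then show False using H unfolding is_H_theta_def by (meson wf_not_refl)
  qed
  moreover have "|P| <o ?\<theta>" using 1 card_of_Pow ordLess_transitive by blast
  ultimately have "|P| \<le>o |H|" using ordLess_imp_ordLeq ordLeq_transitive by blast
  then obtain c where "inj_on c P" "c ` P \<subseteq> H" using card_of_ordLeq by metis
  then show ?thesis using H co reg 1 2 unfolding large_regular_def by blast
qed

end

theory Submission
  imports Defs "HOL-Library.Countable_Set_Type"
begin

text \<open>
  For a finite set \<open>a\<close> let \<open>large a\<close> consist of the regular open \<open>U\<close> such that for every countable \<open>Y\<close>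
  some \<open>r \<in> U\<close> has \<open>a \<subseteq> w r\<close> and \<open>w r \<inter> Y \<subseteq> a\<close>.  Two members of \<open>large a\<close> contain
  \<open>\<omega>\<^sub>1\<close>-sequences whose \<open>w\<close>-values form Delta-systems with root \<open>a\<close> avoiding \<open>Y\<close>; a compatible pair
  and the union property of \<open>w\<close> put their intersection into \<open>large a\<close>, which is therefore a filter
  unless it is empty.  Given \<open>M\<close> and \<open>q\<close>, the required filter is \<open>large a\<close> for a maximal \<open>a \<subseteq> w q\<close> in
  \<open>M\<close>: if \<open>U \<in> M\<close> contains \<open>q\<close> but is not in \<open>large a\<close>, a countable \<open>Y \<in> M\<close> witnesses this, and as
  \<open>Y \<subseteq> M\<close> some element of \<open>w q \<inter> Y\<close> enlarges \<open>a\<close>.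

  Since \<open>w\<close> need not belong to \<open>M\<close>, elementarity is applied to a single sentence: there are functions
  \<open>f\<close> and \<open>g\<close> in \<open>H\<close> such that every set closed under them contains a suitable filter for every \<open>q\<close>.
  Here \<open>f\<close> maps (a code of) \<open>a\<close> to \<open>large a\<close>, and \<open>g\<close> enumerates the one-point extensions of \<open>a\<close> by
  elements of \<open>Y\<close> as an orbit, so that neither \<open>\<omega>\<close> nor countability has to be defined in \<open>H\<close>.
\<close>

section \<open>Filters from Delta-systems\<close>

text \<open>A proper initial segment of a cardinal has smaller cardinality, and below the successor
  of \<omega> this means countable. Points outside the field have no predecessors, so the index may
  range over the whole type.\<close>

lemma countable_strict_initial_segment_omega1:
  "countable {\<beta>. (\<beta>, \<alpha>) \<in> cardSuc natLeq - Id}"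
proof (cases "\<alpha> \<in> Field (cardSuc natLeq)")
  case True
  have "|underS (cardSuc natLeq) \<alpha>| <o cardSuc natLeq"
    by (rule card_of_underS) (simp_all add: cardSuc_Card_order natLeq_Card_order True)
  then have "|underS (cardSuc natLeq) \<alpha>| \<le>o natLeq"
    by (simp add: cardSuc_ordLeq_ordLess natLeq_Card_order card_of_Card_order)
  then have "countable (underS (cardSuc natLeq) \<alpha>)"
    using countable_card_le_natLeq by blast
  then show ?thesis by (rule countable_subset[rotated]) (auto simp: underS_def)
next
  case False
  then have "{\<beta>. (\<beta>, \<alpha>) \<in> cardSuc natLeq - Id} = {}" by (auto simp: Field_def)
  then show ?thesis by (simp only: countable_empty)
qed

text \<open>The map \<open>h\<close> steps along an enumeration of N, starting from
  \<open>x0\<close>. Closure under one unary map thus takes over the role of the natural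
  numbers.\<close>

lemma countable_subset_orbit:
  assumes "countable N"
  obtains h where "\<And>x. h x \<in> insert x0 N"
    and "\<And>S. x0 \<in> S \<Longrightarrow> (\<And>x. x \<in> S \<Longrightarrow> h x \<in> S) \<Longrightarrow> N \<subseteq> S"
proof -
  \<comment> \<open>As \<open>x0\<close> starts the orbit, it is removed from the enumeration;
    otherwise it would need two successors.\<close>
  define A where "A = N - {x0}"
  have A: "countable A" using assms unfolding A_def by simp
  \<comment> \<open>Past the last index of a finite A, \<open>from_nat_into\<close> still returns an
    element of A, so the values stay inside.\<close>
  define h where "h x = (if A = {} then x0 else if x = x0 then from_nat_into A 0
    else from_nat_into A (Suc (to_nat_on A x)))" for x
  show ?thesis
  proof
    show "h x \<in> insert x0 N" for x
      unfolding h_def using from_nat_into[of A] by (auto simp: A_def)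
  next
    fix S assume S: "x0 \<in> S" "\<And>x. x \<in> S \<Longrightarrow> h x \<in> S"
    have "y \<in> S" if "y \<in> A" "to_nat_on A y = n" for y n
      using that
    proof (induction n arbitrary: y)
      case 0
      then have "y = h x0" using A unfolding h_def by (metis empty_iff from_nat_into_to_nat_on)
      then show ?case using S by simp
    next
      case (Suc n)
      \<comment> \<open>The indices in use form an initial segment of the naturals, so the
        predecessor of a used index is used as well.\<close>
      have "n \<in> to_nat_on A ` A"
      proof (cases "finite A")
        case True
        from bij_betw_imp_surj_on[OF to_nat_on_finite[OF this]] Suc.prems show ?thesis
          by (metis Suc_lessD image_eqI lessThan_iff)
      next
        case False
        from bij_betw_imp_surj_on[OF to_nat_on_infinite[OF A this]] show ?thesis by simp
      qed
      then obtain z where z: "z \<in> A" "to_nat_on A z = n" by blast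
      then have "h z = y" using Suc.prems A unfolding h_def
        by (metis DiffE A_def empty_iff from_nat_into_to_nat_on singletonI)
      then show ?case using S(2)[OF Suc.IH[OF z]] by simp
    qed
    then show "N \<subseteq> S" using S(1) unfolding A_def by blast
  qed
qed

section \<open>Regular open sets\<close>

lemma down_interior_closure_iff:
  "p \<in> down_interior P le (down_closure P le U) \<longleftrightarrow>
     p \<in> P \<and> (\<forall>q\<in>P. (q, p) \<in> le \<longrightarrow> (\<exists>r\<in>U. (r, q) \<in> le))"
  unfolding down_interior_def down_closure_def by auto

text \<open>Membership amounts to density below the point. In this form regularity can be copied
  into the language of sets, which \<open>is_RO\<close> does.\<close>

lemma RO_iff:
  "U \<in> RO P le \<longleftrightarrow> U \<subseteq> P \<and>
     (\<forall>p\<in>P. p \<in> U \<longleftrightarrow> (\<forall>q\<in>P. (q, p) \<in> le \<longrightarrow> (\<exists>r\<in>U. (r, q) \<in> le)))"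
  unfolding RO_def using down_interior_closure_iff[of _ P le U] by blast

section \<open>Posets with finite weights and their large regular open sets\<close>

locale weighted_poset =
  fixes P :: "'a set" and le :: "'a rel" and w :: "'a \<Rightarrow> 'b set"
  assumes poset: "partial_order_on P le"
    and w_finite: "\<And>p. p \<in> P \<Longrightarrow> finite (w p)"
    and w_union: "\<And>p q. p \<in> P \<Longrightarrow> q \<in> P \<Longrightarrow> compatible P le p q \<Longrightarrow>
           \<exists>r\<in>P. (r, p) \<in> le \<and> (r, q) \<in> le \<and> w r = w p \<union> w q"
    and w_delta: "\<And>(p :: nat set \<Rightarrow> 'a) (q :: nat set \<Rightarrow> 'a) (a :: 'b set).
           p ` omega1 \<subseteq> P \<Longrightarrow> q ` omega1 \<subseteq> P \<Longrightarrow>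
           delta_system omega1 (\<lambda>\<alpha>. w (p \<alpha>)) a \<Longrightarrow>
           delta_system omega1 (\<lambda>\<alpha>. w (q \<alpha>)) a \<Longrightarrow>
           \<exists>\<alpha>\<in>omega1. \<exists>\<beta>\<in>omega1. compatible P le (p \<alpha>) (q \<beta>)"
begin

lemma le_refl: "p \<in> P \<Longrightarrow> (p, p) \<in> le"
  using poset by (auto simp: partial_order_on_def preorder_on_def refl_on_def)

lemma le_trans: "(p, q) \<in> le \<Longrightarrow> (q, r) \<in> le \<Longrightarrow> (p, r) \<in> le"
  using poset by (auto simp: partial_order_on_def preorder_on_def dest: transD)

lemma le_carrier: "le \<subseteq> P \<times> P"
  using poset by (auto simp: partial_order_on_def preorder_on_def)

text \<open>Density below a point passes to every stronger point.\<close>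

lemma RO_down:
  assumes U: "U \<in> RO P le" and p: "p \<in> U" and q: "(q, p) \<in> le"
  shows "q \<in> U"
proof -
  have P: "p \<in> P" "q \<in> P" using q le_carrier by auto
  have "\<forall>r\<in>P. (r, p) \<in> le \<longrightarrow> (\<exists>s\<in>U. (s, r) \<in> le)" using U p P by (simp add: RO_iff)
  then have "\<forall>r\<in>P. (r, q) \<in> le \<longrightarrow> (\<exists>s\<in>U. (s, r) \<in> le)" using q by (meson le_trans)
  then show ?thesis using U P by (simp add: RO_iff)
qed

lemma RO_Int:
  assumes "U \<in> RO P le" "V \<in> RO P le" shows "U \<inter> V \<in> RO P le"
  unfolding RO_iff
proof (intro conjI ballI iffI impI)
  show "U \<inter> V \<subseteq> P" using assms by (auto simp: RO_iff)
next
  fix p q assume "p \<in> U \<inter> V" "q \<in> P" "(q, p) \<in> le"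
  then show "\<exists>r\<in>U \<inter> V. (r, q) \<in> le" using RO_down assms le_refl by blast
next
  fix p assume p: "p \<in> P" "\<forall>q\<in>P. (q, p) \<in> le \<longrightarrow> (\<exists>r\<in>U \<inter> V. (r, q) \<in> le)"
  \<comment> \<open>If the intersection is dense below p, so is each of the two sets, and the
    regularity of each applies.\<close>
  have "p \<in> X" if "X \<in> RO P le" "U \<inter> V \<subseteq> X" for X
  proof -
    have "\<forall>q\<in>P. (q, p) \<in> le \<longrightarrow> (\<exists>r\<in>X. (r, q) \<in> le)" using p(2) that(2) by (meson subsetD)
    then show ?thesis using that(1) p(1) by (simp add: RO_iff)
  qed
  then show "p \<in> U \<inter> V" using assms by simp
qed

lemma carrier_RO: "P \<in> RO P le"
  unfolding RO_iff using le_refl by blast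

lemma RO_embed_self: "q \<in> P \<Longrightarrow> q \<in> RO_embed P le q"
  unfolding RO_embed_def down_interior_closure_iff using le_refl by blast


text \<open>One equation carries two requirements: a is contained in \<open>w r\<close>, and
  \<open>w r\<close> meets Y only inside a.\<close>

definition large :: "'b set \<Rightarrow> 'a set set" where
  "large a = {U \<in> RO P le. \<forall>Y. countable Y \<longrightarrow> (\<exists>r\<in>U. w r \<inter> (Y \<union> a) = a)}"

text \<open>Recursion along \<omega>_1: each stage applies largeness to Y together with all
  \<open>w\<close>-values chosen before, so the new value meets every earlier one exactly in
  a.\<close>

lemma large_delta_system:
  assumes U: "U \<in> large a" and Y: "countable Y"
  obtains p :: "nat set \<Rightarrow> 'a" where "range p \<subseteq> U"
    and "delta_system omega1 (\<lambda>\<alpha>. w (p \<alpha>)) a" and "\<And>\<alpha>. w (p \<alpha>) \<inter> (Y \<union> a) = a"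
proof -
  let ?R = "cardSuc natLeq - Id"
  have wo: "Well_order (cardSuc natLeq)"
    using cardSuc_Card_order[OF natLeq_Card_order] card_order_on_well_order_on by blast
  then have wf: "wf ?R" by (simp add: well_order_on_def)
  have UP: "U \<subseteq> P" using U by (auto simp: large_def RO_iff)
  have "\<exists>p. \<forall>\<alpha>. p \<alpha> \<in> U \<and> w (p \<alpha>) \<inter> (Y \<union> (\<Union>\<beta>\<in>{\<beta>. (\<beta>, \<alpha>) \<in> ?R}. w (p \<beta>)) \<union> a) = a"
  proof (rule dependent_wf_choice[OF wf])
    fix \<alpha> p assume IH: "\<And>\<beta>. (\<beta>, \<alpha>) \<in> ?R \<Longrightarrow>
      p \<beta> \<in> U \<and> w (p \<beta>) \<inter> (Y \<union> (\<Union>\<gamma>\<in>{\<gamma>. (\<gamma>, \<beta>) \<in> ?R}. w (p \<gamma>)) \<union> a) = a"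
    \<comment> \<open>Each of the countably many earlier stages contributes a finite set.\<close>
    have "countable (w (p \<beta>))" if "(\<beta>, \<alpha>) \<in> ?R" for \<beta>
      using IH[OF that] UP by (simp add: countable_finite subsetD w_finite)
    then have "countable (Y \<union> (\<Union>\<beta>\<in>{\<beta>. (\<beta>, \<alpha>) \<in> ?R}. w (p \<beta>)))"
      using countable_strict_initial_segment_omega1 Y by (intro countable_Un countable_UN) blast+
    then show "\<exists>r. r \<in> U \<and> w r \<inter> (Y \<union> (\<Union>\<beta>\<in>{\<beta>. (\<beta>, \<alpha>) \<in> ?R}. w (p \<beta>)) \<union> a) = a"
      using U by (auto simp: large_def)
  next
    \<comment> \<open>Well-founded choice asks that the condition at a stage depend only on the
      choices at earlier stages.\<close>
    fix p p' :: "nat set \<Rightarrow> 'a" and \<alpha> r assume "\<And>\<beta>. (\<beta>, \<alpha>) \<in> ?R \<Longrightarrow> p \<beta> = p' \<beta>"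
    then have "(\<Union>\<beta>\<in>{\<beta>. (\<beta>, \<alpha>) \<in> ?R}. w (p \<beta>)) = (\<Union>\<beta>\<in>{\<beta>. (\<beta>, \<alpha>) \<in> ?R}. w (p' \<beta>))"
      by (intro SUP_cong) auto
    then show "(r \<in> U \<and> w r \<inter> (Y \<union> (\<Union>\<beta>\<in>{\<beta>. (\<beta>, \<alpha>) \<in> ?R}. w (p \<beta>)) \<union> a) = a) =
      (r \<in> U \<and> w r \<inter> (Y \<union> (\<Union>\<beta>\<in>{\<beta>. (\<beta>, \<alpha>) \<in> ?R}. w (p' \<beta>)) \<union> a) = a)" by (simp only:)
  qed
  then obtain p where *: "\<forall>\<alpha>. p \<alpha> \<in> U \<and>
    w (p \<alpha>) \<inter> (Y \<union> (\<Union>\<beta>\<in>{\<beta>. (\<beta>, \<alpha>) \<in> ?R}. w (p \<beta>)) \<union> a) = a" by (rule exE)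
  have pU: "p \<alpha> \<in> U" for \<alpha> using * by (rule allE) (erule conjunct1)
  have p: "w (p \<alpha>) \<inter> (Y \<union> (\<Union>\<beta>\<in>{\<beta>. (\<beta>, \<alpha>) \<in> ?R}. w (p \<beta>)) \<union> a) = a" for \<alpha>
    using * by (rule allE) (erule conjunct2)
  have less: "w (p \<alpha>) \<inter> w (p \<beta>) = a" if "(\<beta>, \<alpha>) \<in> ?R" for \<alpha> \<beta>
  proof
    have "w (p \<alpha>) \<inter> w (p \<beta>) \<subseteq> w (p \<alpha>) \<inter> (Y \<union> (\<Union>\<beta>\<in>{\<beta>. (\<beta>, \<alpha>) \<in> ?R}. w (p \<beta>)) \<union> a)"
      using that by auto
    then show "w (p \<alpha>) \<inter> w (p \<beta>) \<subseteq> a" by (simp only: p)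
    show "a \<subseteq> w (p \<alpha>) \<inter> w (p \<beta>)" using p[of \<alpha>] p[of \<beta>] by (metis Int_lower1 Int_greatest)
  qed
  have "w (p \<alpha>) \<inter> w (p \<beta>) = a" if "\<alpha> \<in> omega1" "\<beta> \<in> omega1" "\<alpha> \<noteq> \<beta>" for \<alpha> \<beta>
  proof -
    \<comment> \<open>Intersection is symmetric, so it is enough to control the later index against
      the earlier one.\<close>
    have "(\<alpha>, \<beta>) \<in> ?R \<or> (\<beta>, \<alpha>) \<in> ?R"
      using wo that unfolding omega1_def well_order_on_def linear_order_on_def total_on_def by blast
    then show ?thesis using less[of \<alpha> \<beta>] less[of \<beta> \<alpha>] Int_commute by metis
  qed
  then have "delta_system omega1 (\<lambda>\<alpha>. w (p \<alpha>)) a" by (simp add: delta_system_def)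
  moreover have "w (p \<alpha>) \<inter> (Y \<union> a) = a" for \<alpha>
  proof -
    have "A \<inter> (Y \<union> B \<union> a) = a \<Longrightarrow> A \<inter> (Y \<union> a) = a" for A B :: "'b set" by auto
    then show ?thesis using p by this
  qed
  moreover have "range p \<subseteq> U" using pU by (simp add: image_subset_iff)
  ultimately show ?thesis using that[of p] by simp
qed

text \<open>Here \<open>w_delta\<close> and \<open>w_union\<close> enter. The sequences inside U and
  V have the common root a, so some pair is compatible; the trace on \<open>Y \<union> a\<close> of
  the lower bound from \<open>w_union\<close> is the union of two traces equal to a.\<close>

lemma large_Int:
  assumes U: "U \<in> large a" and V: "V \<in> large a" shows "U \<inter> V \<in> large a"
proof -
  have RO: "U \<in> RO P le" "V \<in> RO P le" using U V by (auto simp: large_def)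
  have "\<exists>r\<in>U \<inter> V. w r \<inter> (Y \<union> a) = a" if Y: "countable Y" for Y
  proof -
    obtain p where p: "range p \<subseteq> U" "delta_system omega1 (\<lambda>\<alpha>. w (p \<alpha>)) a"
      "\<And>\<alpha>. w (p \<alpha>) \<inter> (Y \<union> a) = a" using large_delta_system[OF U Y] by blast
    obtain q where q: "range q \<subseteq> V" "delta_system omega1 (\<lambda>\<alpha>. w (q \<alpha>)) a"
      "\<And>\<alpha>. w (q \<alpha>) \<inter> (Y \<union> a) = a" using large_delta_system[OF V Y] by blast
    have pq: "range p \<subseteq> P" "range q \<subseteq> P" using p(1) q(1) RO by (auto simp: RO_iff)
    then obtain \<alpha> \<beta> where "compatible P le (p \<alpha>) (q \<beta>)"
      using w_delta[of p q a] p(2) q(2) by blast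
    then obtain r where r: "(r, p \<alpha>) \<in> le" "(r, q \<beta>) \<in> le" "w r = w (p \<alpha>) \<union> w (q \<beta>)"
      using w_union[of "p \<alpha>" "q \<beta>"] pq by blast
    then have "r \<in> U \<inter> V" using RO_down RO p(1) q(1) by blast
    moreover have "w r \<inter> (Y \<union> a) = a" using r(3) p(3)[of \<alpha>] q(3)[of \<beta>] by blast
    ultimately show ?thesis by blast
  qed
  then show ?thesis using RO_Int[OF RO] by (simp add: large_def)
qed

lemma large_mono: "U \<in> large a \<Longrightarrow> V \<in> RO P le \<Longrightarrow> U \<subseteq> V \<Longrightarrow> V \<in> large a"
  unfolding large_def mem_Collect_eq by (meson subsetD)

lemma empty_not_large: "{} \<notin> large a"
  unfolding large_def by auto

end

section \<open>Formulas\<close>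

text \<open>Bound variables are chosen larger than all free ones, so that no capture occurs.\<close>

definition FImp :: "fm \<Rightarrow> fm \<Rightarrow> fm" where
  "FImp \<phi> \<psi> = FNeg (FConj \<phi> (FNeg \<psi>))"

definition FIff :: "fm \<Rightarrow> fm \<Rightarrow> fm" where
  "FIff \<phi> \<psi> = FConj (FImp \<phi> \<psi>) (FImp \<psi> \<phi>)"

definition FAll :: "nat \<Rightarrow> fm \<Rightarrow> fm" where
  "FAll i \<phi> = FNeg (FEx i (FNeg \<phi>))"

definition FOr :: "fm \<Rightarrow> fm \<Rightarrow> fm" where
  "FOr \<phi> \<psi> = FNeg (FConj (FNeg \<phi>) (FNeg \<psi>))"

lemma sat_connectives [simp]:
  "sat H E v (FImp \<phi> \<psi>) \<longleftrightarrow> (sat H E v \<phi> \<longrightarrow> sat H E v \<psi>)"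
  "sat H E v (FIff \<phi> \<psi>) \<longleftrightarrow> (sat H E v \<phi> \<longleftrightarrow> sat H E v \<psi>)"
  "sat H E v (FOr \<phi> \<psi>) \<longleftrightarrow> (sat H E v \<phi> \<or> sat H E v \<psi>)"
  "sat H E v (FAll i \<phi>) \<longleftrightarrow> (\<forall>x\<in>H. sat H E (v(i := x)) \<phi>)"
  by (auto simp: FImp_def FIff_def FOr_def FAll_def)

text \<open>Kuratowski pairs with all quantifiers ranging over H. This predicate and those below are
  each matched with a formula by a satisfaction lemma.\<close>

definition is_pair :: "'h set \<Rightarrow> 'h rel \<Rightarrow> 'h \<Rightarrow> 'h \<Rightarrow> 'h \<Rightarrow> bool" where
  "is_pair H E z x y \<longleftrightarrow> (\<exists>a\<in>H. \<exists>b\<in>H.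
     (\<forall>t\<in>H. (t, z) \<in> E \<longleftrightarrow> t = a \<or> t = b) \<and>
     (\<forall>t\<in>H. (t, a) \<in> E \<longleftrightarrow> t = x) \<and>
     (\<forall>t\<in>H. (t, b) \<in> E \<longleftrightarrow> t = x \<or> t = y))"

definition pair_fm :: "nat \<Rightarrow> nat \<Rightarrow> nat \<Rightarrow> fm" where
  "pair_fm z x y = (let a = Suc (z + x + y); b = Suc a; t = Suc b in
     FEx a (FEx b (FConj (FAll t (FIff (FMem t z) (FOr (FEq t a) (FEq t b))))
       (FConj (FAll t (FIff (FMem t a) (FEq t x)))
         (FAll t (FIff (FMem t b) (FOr (FEq t x) (FEq t y))))))))"

lemma sat_pair_fm [simp]: "sat H E v (pair_fm z x y) \<longleftrightarrow> is_pair H E (v z) (v x) (v y)"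
  by (simp add: pair_fm_def is_pair_def Let_def)

text \<open>Single-valuedness is a separate condition, because the order of the poset is read
  through the same predicate.\<close>

definition maps_to :: "'h set \<Rightarrow> 'h rel \<Rightarrow> 'h \<Rightarrow> 'h \<Rightarrow> 'h \<Rightarrow> bool" where
  "maps_to H E f x y \<longleftrightarrow> (\<exists>t\<in>H. is_pair H E t x y \<and> (t, f) \<in> E)"

definition maps_to_fm :: "nat \<Rightarrow> nat \<Rightarrow> nat \<Rightarrow> fm" where
  "maps_to_fm f x y = (let t = Suc (f + x + y) in FEx t (FConj (pair_fm t x y) (FMem t f)))"

lemma sat_maps_to_fm [simp]: "sat H E v (maps_to_fm f x y) \<longleftrightarrow> maps_to H E (v f) (v x) (v y)"
  by (simp add: maps_to_fm_def maps_to_def Let_def)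

definition is_RO :: "'h set \<Rightarrow> 'h rel \<Rightarrow> 'h \<Rightarrow> 'h \<Rightarrow> 'h \<Rightarrow> bool" where
  "is_RO H E P L U \<longleftrightarrow> (\<forall>p\<in>H. (p, U) \<in> E \<longrightarrow> (p, P) \<in> E) \<and>
     (\<forall>p\<in>H. (p, P) \<in> E \<longrightarrow>
       ((p, U) \<in> E \<longleftrightarrow> (\<forall>q\<in>H. (q, P) \<in> E \<longrightarrow> maps_to H E L q p \<longrightarrow>
         (\<exists>r\<in>H. (r, U) \<in> E \<and> maps_to H E L r q))))"

definition RO_fm :: "nat \<Rightarrow> nat \<Rightarrow> nat \<Rightarrow> fm" where
  "RO_fm P L U = (let p = Suc (P + L + U); q = Suc p; r = Suc q in
     FConj (FAll p (FImp (FMem p U) (FMem p P)))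
       (FAll p (FImp (FMem p P)
         (FIff (FMem p U) (FAll q (FImp (FMem q P) (FImp (maps_to_fm L q p)
           (FEx r (FConj (FMem r U) (maps_to_fm L r q))))))))))"

lemma sat_RO_fm [simp]: "sat H E v (RO_fm P L U) \<longleftrightarrow> is_RO H E (v P) (v L) (v U)"
  by (simp add: RO_fm_def is_RO_def Let_def)

text \<open>The empty family is not excluded here.\<close>

definition is_RO_filter :: "'h set \<Rightarrow> 'h rel \<Rightarrow> 'h \<Rightarrow> 'h \<Rightarrow> 'h \<Rightarrow> bool" where
  "is_RO_filter H E P L F \<longleftrightarrow>
     (\<forall>U\<in>H. (U, F) \<in> E \<longrightarrow> is_RO H E P L U \<and> (\<exists>p\<in>H. (p, U) \<in> E)) \<and>
     (\<forall>U\<in>H. \<forall>V\<in>H. (U, F) \<in> E \<longrightarrow> is_RO H E P L V \<longrightarrow>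
        (\<forall>p\<in>H. (p, U) \<in> E \<longrightarrow> (p, V) \<in> E) \<longrightarrow> (V, F) \<in> E) \<and>
     (\<forall>U\<in>H. \<forall>V\<in>H. \<forall>W\<in>H. (U, F) \<in> E \<longrightarrow> (V, F) \<in> E \<longrightarrow>
        (\<forall>p\<in>H. (p, W) \<in> E \<longleftrightarrow> (p, U) \<in> E \<and> (p, V) \<in> E) \<longrightarrow> (W, F) \<in> E)"

definition RO_filter_fm :: "nat \<Rightarrow> nat \<Rightarrow> nat \<Rightarrow> fm" where
  "RO_filter_fm P L F = (let U = Suc (P + L + F); V = Suc U; W = Suc V; p = Suc W in
     FConj (FAll U (FImp (FMem U F) (FConj (RO_fm P L U) (FEx p (FMem p U)))))
      (FConj (FAll U (FAll V (FImp (FMem U F) (FImp (RO_fm P L V)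
          (FImp (FAll p (FImp (FMem p U) (FMem p V))) (FMem V F))))))
        (FAll U (FAll V (FAll W (FImp (FMem U F) (FImp (FMem V F)
          (FImp (FAll p (FIff (FMem p W) (FConj (FMem p U) (FMem p V)))) (FMem W F)))))))))"

lemma sat_RO_filter_fm [simp]: "sat H E v (RO_filter_fm P L F) \<longleftrightarrow> is_RO_filter H E (v P) (v L) (v F)"
  by (simp add: RO_filter_fm_def is_RO_filter_def Let_def)

definition is_function :: "'h set \<Rightarrow> 'h rel \<Rightarrow> 'h \<Rightarrow> bool" where
  "is_function H E f \<longleftrightarrow>
     (\<forall>x\<in>H. \<forall>y\<in>H. \<forall>z\<in>H. maps_to H E f x y \<longrightarrow> maps_to H E f x z \<longrightarrow> y = z)"

definition function_fm :: "nat \<Rightarrow> fm" where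
  "function_fm f = (let x = Suc f; y = Suc x; z = Suc y in
     FAll x (FAll y (FAll z (FImp (maps_to_fm f x y) (FImp (maps_to_fm f x z) (FEq y z))))))"

lemma sat_function_fm [simp]: "sat H E v (function_fm f) \<longleftrightarrow> is_function H E (v f)"
  by (simp add: function_fm_def is_function_def Let_def)

definition closed_under :: "'h set \<Rightarrow> 'h rel \<Rightarrow> 'h \<Rightarrow> 'h \<Rightarrow> bool" where
  "closed_under H E f D \<longleftrightarrow>
     (\<forall>x\<in>H. \<forall>y\<in>H. (x, D) \<in> E \<longrightarrow> maps_to H E f x y \<longrightarrow> (y, D) \<in> E)"

definition closed_under_fm :: "nat \<Rightarrow> nat \<Rightarrow> fm" where
  "closed_under_fm f D = (let x = Suc (f + D); y = Suc x in
     FAll x (FAll y (FImp (FMem x D) (FImp (maps_to_fm f x y) (FMem y D)))))"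

lemma sat_closed_under_fm [simp]:
  "sat H E v (closed_under_fm f D) \<longleftrightarrow> closed_under H E (v f) (v D)"
  by (simp add: closed_under_fm_def closed_under_def Let_def)

text \<open>The arguments of g are triples coded by nested pairs; these codes must lie in D before
  closure under g can be applied.\<close>

definition closed_pairs :: "'h set \<Rightarrow> 'h rel \<Rightarrow> 'h \<Rightarrow> bool" where
  "closed_pairs H E D \<longleftrightarrow> (\<forall>x\<in>H. \<forall>y\<in>H. \<forall>z\<in>H.
     (x, D) \<in> E \<longrightarrow> (y, D) \<in> E \<longrightarrow> is_pair H E z x y \<longrightarrow> (z, D) \<in> E)"

definition closed_pairs_fm :: "nat \<Rightarrow> fm" where
  "closed_pairs_fm D = (let x = Suc D; y = Suc x; z = Suc y in
     FAll x (FAll y (FAll z (FImp (FMem x D) (FImp (FMem y D)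
       (FImp (pair_fm z x y) (FMem z D)))))))"

lemma sat_closed_pairs_fm [simp]: "sat H E v (closed_pairs_fm D) \<longleftrightarrow> closed_pairs H E (v D)"
  by (simp add: closed_pairs_fm_def closed_pairs_def Let_def)

text \<open>The functions \<open>f\<close> and \<open>g\<close> witness Y-c.c. for every set \<open>D\<close> that is closed under them, not
  only for elementary submodels; this is what makes their existence expressible in \<open>H\<close>.\<close>

definition Ycc_algebra :: "'h set \<Rightarrow> 'h rel \<Rightarrow> 'h \<Rightarrow> 'h \<Rightarrow> 'h \<Rightarrow> 'h \<Rightarrow> 'h \<Rightarrow> bool" where
  "Ycc_algebra H E P L k f g \<longleftrightarrow> is_function H E f \<and> is_function H E g \<and>
     (\<forall>D\<in>H. (k, D) \<in> E \<longrightarrow> closed_pairs H E D \<longrightarrow> closed_under H E f D \<longrightarrow> closed_under H E g D \<longrightarrow>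
       (\<forall>q\<in>H. (q, P) \<in> E \<longrightarrow> (\<exists>F\<in>H. (F, D) \<in> E \<and> is_RO_filter H E P L F \<and>
         (\<forall>U\<in>H. (U, D) \<in> E \<longrightarrow> is_RO H E P L U \<longrightarrow> (q, U) \<in> E \<longrightarrow> (U, F) \<in> E))))"

definition Ycc_algebra_fm :: "nat \<Rightarrow> nat \<Rightarrow> nat \<Rightarrow> nat \<Rightarrow> nat \<Rightarrow> fm" where
  "Ycc_algebra_fm P L k f g = (let D = Suc (P + L + k + f + g); q = Suc D; F = Suc q; U = Suc F in
     FConj (function_fm f) (FConj (function_fm g)
       (FAll D (FImp (FMem k D) (FImp (closed_pairs_fm D) (FImp (closed_under_fm f D)
         (FImp (closed_under_fm g D) (FAll q (FImp (FMem q P)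
           (FEx F (FConj (FMem F D) (FConj (RO_filter_fm P L F)
             (FAll U (FImp (FMem U D) (FImp (RO_fm P L U) (FImp (FMem q U) (FMem U F)))))))))))))))))"

lemma sat_Ycc_algebra_fm [simp]: "sat H E v (Ycc_algebra_fm P L k f g) \<longleftrightarrow>
    Ycc_algebra H E (v P) (v L) (v k) (v f) (v g)"
  by (simp add: Ycc_algebra_fm_def Ycc_algebra_def Let_def)

text \<open>Elementarity is used twice: downwards to find a witness in M, and upwards to return to
  satisfaction in H.\<close>

lemma elementary_submodel_witness:
  assumes "elementary_submodel M H E" "range v \<subseteq> M" "sat H E v (FEx i \<phi>)"
  obtains x where "x \<in> M" "sat H E (v(i := x)) \<phi>"
proof -
  have "sat M E v (FEx i \<phi>)" using assms unfolding elementary_submodel_def by blast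
  then obtain x where x: "x \<in> M" "sat M E (v(i := x)) \<phi>" by auto
  moreover have "range (v(i := x)) \<subseteq> M" using assms(2) x(1) by auto
  ultimately show ?thesis using assms(1) that unfolding elementary_submodel_def by blast
qed

section \<open>Coding in the structure \<open>H\<^sub>\<theta>\<close>\<close>

locale H_theta =
  fixes \<theta> :: "'h rel" and H :: "'h set" and E :: "'h rel"
  assumes theta: "Card_order \<theta>" "regularCard \<theta>" "natLeq <o \<theta>"
    and H_theta: "is_H_theta \<theta> H E"
begin

lemma infinite_theta: "infinite (Field \<theta>)"
proof -
  have "\<theta> =o |Field \<theta>|" using theta(1) card_of_Field_ordIso ordIso_symmetric by blast
  then have "natLeq \<le>o |Field \<theta>|" using theta(3) ordLess_ordIso_trans ordLess_imp_ordLeq by blast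
  then show ?thesis using infinite_iff_natLeq_ordLeq by blast
qed

lemma stable_theta: "stable \<theta>"
  using theta infinite_theta by (simp add: regularCard_stable)

lemma small_countable: "countable X \<Longrightarrow> |X| <o \<theta>"
  using theta(3) countable_card_le_natLeq ordLeq_ordLess_trans by blast

lemma small_image: "|X| <o \<theta> \<Longrightarrow> |f ` X| <o \<theta>"
  using card_of_image ordLeq_ordLess_trans by blast

lemma small_subset: "|X| <o \<theta> \<Longrightarrow> Y \<subseteq> X \<Longrightarrow> |Y| <o \<theta>"
  using card_of_mono1 ordLeq_ordLess_trans by blast

lemma small_Times: "|X| <o \<theta> \<Longrightarrow> |Y| <o \<theta> \<Longrightarrow> |X \<times> Y| <o \<theta>"
  by (rule stable_elim[OF stable_theta])

lemma E_in_H: "(y, x) \<in> E \<Longrightarrow> y \<in> H" "(y, x) \<in> E \<Longrightarrow> x \<in> H"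
  using H_theta by (auto simp: is_H_theta_def)

lemma elts_subset: "elts E x \<subseteq> H"
  unfolding elts_def using E_in_H by blast

lemma extensionality:
  assumes "x \<in> H" "y \<in> H" "\<And>t. t \<in> H \<Longrightarrow> (t, x) \<in> E \<longleftrightarrow> (t, y) \<in> E"
  shows "x = y"
proof -
  have "elts E x = elts E y" using assms(3) E_in_H unfolding elts_def by blast
  then show ?thesis using assms(1,2) H_theta unfolding is_H_theta_def by (meson inj_onD)
qed

lemma set_code_elts: "x \<in> H \<Longrightarrow> set_code H E (elts E x) = x"
  unfolding set_code_def
  using H_theta by (auto intro!: the_equality dest: inj_onD simp: is_H_theta_def)

lemma set_code:
  assumes "X \<subseteq> H" "|X| <o \<theta>"
  shows "set_code H E X \<in> H" "elts E (set_code H E X) = X"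
proof -
  obtain x where "x \<in> H" "elts E x = X" using H_theta assms unfolding is_H_theta_def by blast
  then show "set_code H E X \<in> H" "elts E (set_code H E X) = X" using set_code_elts by auto
qed

lemma mem_set_code: "X \<subseteq> H \<Longrightarrow> |X| <o \<theta> \<Longrightarrow> (y, set_code H E X) \<in> E \<longleftrightarrow> y \<in> X"
  using set_code(2)[of X] unfolding elts_def by blast

lemma small_finite: "finite X \<Longrightarrow> |X| <o \<theta>"
  by (simp add: small_countable countable_finite)

lemma pair_code_in_H: "x \<in> H \<Longrightarrow> y \<in> H \<Longrightarrow> pair_code H E x y \<in> H"
  unfolding pair_code_def by (simp add: set_code small_finite)

text \<open>Finite subsets of H have codes in H, and extensionality determines both inner sets and
  then z.\<close>

lemma is_pair_iff:
  assumes "x \<in> H" "y \<in> H" "z \<in> H"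
  shows "is_pair H E z x y \<longleftrightarrow> z = pair_code H E x y"
proof
  let ?a = "set_code H E {x}" and ?b = "set_code H E {x, y}"
  have ab: "?a \<in> H" "?b \<in> H" using assms by (simp_all add: set_code small_finite)
  have mem: "(t, ?a) \<in> E \<longleftrightarrow> t = x" "(t, ?b) \<in> E \<longleftrightarrow> t = x \<or> t = y"
    "(t, set_code H E {?a, ?b}) \<in> E \<longleftrightarrow> t = ?a \<or> t = ?b" for t
    using assms ab by (simp_all add: mem_set_code small_finite)
  show "is_pair H E z x y" if "z = pair_code H E x y"
    unfolding is_pair_def that pair_code_def using ab mem by blast
  assume "is_pair H E z x y"
  then obtain a b where *: "a \<in> H" "b \<in> H" "\<forall>t\<in>H. (t, z) \<in> E \<longleftrightarrow> t = a \<or> t = b"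
    "\<forall>t\<in>H. (t, a) \<in> E \<longleftrightarrow> t = x" "\<forall>t\<in>H. (t, b) \<in> E \<longleftrightarrow> t = x \<or> t = y"
    unfolding is_pair_def by (elim bexE conjE)
  have "a = ?a" by (rule extensionality) (simp_all add: * ab mem)
  moreover have "b = ?b" by (rule extensionality) (simp_all add: * ab mem)
  ultimately have "z = set_code H E {?a, ?b}"
    using *(3) ab mem(3) assms(3) by (intro extensionality) (simp_all add: set_code small_finite)
  then show "z = pair_code H E x y" by (simp add: pair_code_def)
qed

lemma pair_code_inject:
  assumes "x \<in> H" "y \<in> H" "x' \<in> H" "y' \<in> H"
  shows "pair_code H E x y = pair_code H E x' y' \<longleftrightarrow> x = x' \<and> y = y'"
proof -
  have code_inj: "set_code H E X = set_code H E Y \<longleftrightarrow> X = Y"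
    if "X \<subseteq> H" "Y \<subseteq> H" "finite X" "finite Y" for X Y
    using that set_code(2) small_finite by metis
  have "set_code H E {x} \<in> H" "set_code H E {x, y} \<in> H"
    "set_code H E {x'} \<in> H" "set_code H E {x', y'} \<in> H"
    using assms by (simp_all add: set_code small_finite)
  then show ?thesis unfolding pair_code_def
    using assms by (simp add: code_inj doubleton_eq_iff) blast
qed

lemma maps_to_iff:
  "x \<in> H \<Longrightarrow> y \<in> H \<Longrightarrow> maps_to H E f x y \<longleftrightarrow> (pair_code H E x y, f) \<in> E"
  unfolding maps_to_def using is_pair_iff pair_code_in_H by blast

lemma closed_pairsD:
  assumes "closed_pairs H E D" "(x, D) \<in> E" "(y, D) \<in> E"
  shows "(pair_code H E x y, D) \<in> E"
proof -
  have H: "x \<in> H" "y \<in> H" using assms(2,3) E_in_H(1) by auto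
  have z: "pair_code H E x y \<in> H" by (rule pair_code_in_H[OF H])
  have "is_pair H E (pair_code H E x y) x y" using is_pair_iff[OF H z] by simp
  then show ?thesis
    using assms(1)[unfolded closed_pairs_def, rule_format, OF H z assms(2,3)] by simp
qed

lemma closed_underD:
  assumes "closed_under H E f D" "(x, D) \<in> E" "y \<in> H" "maps_to H E f x y"
  shows "(y, D) \<in> E"
  by (rule assms(1)[unfolded closed_under_def, rule_format, OF E_in_H(1)[OF assms(2)] assms(3,2,4)])

text \<open>Otherwise H would be small, hence the set of elements of one of its own members, and
  that member would belong to itself.\<close>

lemma theta_le_card_H: "\<theta> \<le>o |H|"
proof (rule ccontr)
  assume "\<not> \<theta> \<le>o |H|"
  then have "|H| <o \<theta>"
    using not_ordLeq_iff_ordLess[OF card_of_Well_order card_order_on_well_order_on[OF theta(1)]]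
    by blast
  then have "(set_code H E H, set_code H E H) \<in> E"
    using mem_set_code set_code(1) by blast
  then show False using H_theta unfolding is_H_theta_def by (meson wf_not_refl)
qed

text \<open>The values of \<open>w\<close> live in a type unrelated to H. This supplies arbitrary
  codes for the finite sets built from them.\<close>

lemma small_inj_into_H:
  assumes "|X| <o \<theta>"
  obtains j where "inj_on j X" "j ` X \<subseteq> H"
  using assms theta_le_card_H card_of_ordLeq[of X H] ordLess_imp_ordLeq ordLeq_transitive by blast

end

section \<open>Roots and their one-point extensions\<close>

context weighted_poset
begin

text \<open>These are the candidates for a. The explicit empty set gives the orbits a starting point
  even if P is empty.\<close>

definition roots :: "'b set set" where
  "roots = insert {} (\<Union>q\<in>P. Pow (w q))"

text \<open>The map \<open>h\<close> depends only on U and a, while S and q vary afterwards; this is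
  what allows all these maps to be collected into one function g in H.\<close>

lemma root_extension:
  obtains h where "\<And>x. h x \<in> roots"
    and "\<And>S q. {} \<in> S \<Longrightarrow> (\<And>x. x \<in> S \<Longrightarrow> h x \<in> S) \<Longrightarrow> U \<in> RO P le \<Longrightarrow> U \<notin> large a \<Longrightarrow>
      q \<in> U \<Longrightarrow> a \<subseteq> w q \<Longrightarrow> \<exists>x\<in>w q - a. insert x a \<in> S"
proof -
  \<comment> \<open>Y witnesses that U is not large; in the remaining cases the empty set serves as
    a default.\<close>
  obtain Y where Y: "countable Y"
    "U \<in> RO P le \<Longrightarrow> U \<notin> large a \<Longrightarrow> \<forall>r\<in>U. w r \<inter> (Y \<union> a) \<noteq> a"
  proof (cases "U \<in> RO P le \<and> U \<notin> large a")
    case True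
    then show ?thesis using that unfolding large_def by blast
  next
    case False
    then show ?thesis using that[of "{}"] by blast
  qed
  \<comment> \<open>Intersecting with \<open>roots\<close> keeps every extension contained in some
    \<open>w q\<close>, so each value of \<open>h\<close> will have a code.\<close>
  define N where "N = (\<lambda>x. insert x a) ` Y \<inter> roots"
  have "countable N" using Y(1) unfolding N_def by (simp add: countable_Int1)
  then obtain h where h: "\<And>x. h x \<in> insert {} N"
    "\<And>S. {} \<in> S \<Longrightarrow> (\<And>x. x \<in> S \<Longrightarrow> h x \<in> S) \<Longrightarrow> N \<subseteq> S"
    using countable_subset_orbit by metis
  show ?thesis
  proof
    show "h x \<in> roots" for x using h(1)[of x] unfolding N_def roots_def by auto
  next
    fix S q assume S: "{} \<in> S" "\<And>x. x \<in> S \<Longrightarrow> h x \<in> S"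
      and U: "U \<in> RO P le" "U \<notin> large a" "q \<in> U" "a \<subseteq> w q"
    \<comment> \<open>As a is contained in \<open>w q\<close>, the trace can differ from a only by a
      new point of Y.\<close>
    have "w q \<inter> (Y \<union> a) \<noteq> a" using Y(2) U by simp
    then obtain x where x: "x \<in> Y" "x \<in> w q" "x \<notin> a" using U(4) by auto
    have "q \<in> P" using U(1,3) by (auto simp: RO_iff)
    then have "insert x a \<in> N" using x U(4) unfolding N_def roots_def by auto
    then show "\<exists>x\<in>w q - a. insert x a \<in> S" using x h(2)[OF S] by auto
  qed
qed

end

section \<open>The coded poset\<close>

locale coded_poset = weighted_poset P le w + H_theta \<theta> H E
  for P :: "'a set" and le w and \<theta> H and E :: "'h rel" +
  fixes c :: "'a \<Rightarrow> 'h"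
  assumes Pow_small: "|Pow P| <o \<theta>" and c_inj: "inj_on c P" and c_H: "c ` P \<subseteq> H"
begin

abbreviation "pair \<equiv> pair_code H E"
abbreviation "sub \<equiv> subset_code H E c"
abbreviation "fam \<equiv> family_code H E c"

definition "Pc = set_code H E (c ` P)"
definition "Lc = set_code H E ((\<lambda>(p, q). pair (c p) (c q)) ` le)"

lemma P_small: "|P| <o \<theta>"
  using Pow_small card_of_Pow ordLess_transitive by blast

lemma c_in_H: "p \<in> P \<Longrightarrow> c p \<in> H"
  using c_H by auto

lemma Pc_in_H: "Pc \<in> H"
  unfolding Pc_def by (rule set_code) (use c_H small_image P_small in auto)

lemma le_codes: "(\<lambda>(p, q). pair (c p) (c q)) ` le \<subseteq> H" "|(\<lambda>(p, q). pair (c p) (c q)) ` le| <o \<theta>"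
proof -
  show "(\<lambda>(p, q). pair (c p) (c q)) ` le \<subseteq> H"
    using le_carrier c_in_H pair_code_in_H by auto
  show "|(\<lambda>(p, q). pair (c p) (c q)) ` le| <o \<theta>"
    by (rule small_image, rule small_subset[OF small_Times[OF P_small P_small] le_carrier])
qed

lemma Lc_in_H: "Lc \<in> H"
  unfolding Lc_def by (rule set_code) (use le_codes in auto)

lemma mem_Pc: "(x, Pc) \<in> E \<longleftrightarrow> x \<in> c ` P"
  unfolding Pc_def by (rule mem_set_code) (use c_H small_image P_small in auto)

lemma maps_to_Lc:
  assumes "p \<in> P" "q \<in> P"
  shows "maps_to H E Lc (c p) (c q) \<longleftrightarrow> (p, q) \<in> le"
proof -
  have "maps_to H E Lc (c p) (c q) \<longleftrightarrow> pair (c p) (c q) \<in> (\<lambda>(p, q). pair (c p) (c q)) ` le"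
    using assms by (simp add: maps_to_iff c_in_H Lc_def mem_set_code[OF le_codes])
  also have "\<dots> \<longleftrightarrow> (p, q) \<in> le"
  proof
    assume "pair (c p) (c q) \<in> (\<lambda>(p, q). pair (c p) (c q)) ` le"
    then obtain p' q' where *: "(p', q') \<in> le" "pair (c p) (c q) = pair (c p') (c q')" by auto
    moreover have "p' \<in> P" "q' \<in> P" using *(1) le_carrier by auto
    ultimately show "(p, q) \<in> le"
      using assms c_inj by (simp add: pair_code_inject c_in_H inj_on_eq_iff)
  qed force
  finally show ?thesis .
qed

lemma sub_codes: "U \<subseteq> P \<Longrightarrow> c ` U \<subseteq> H" "U \<subseteq> P \<Longrightarrow> |c ` U| <o \<theta>"
  using c_H by (blast, intro small_image small_subset[OF P_small])

lemma sub_in_H: "U \<subseteq> P \<Longrightarrow> sub U \<in> H"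
  unfolding subset_code_def by (rule set_code) (use sub_codes in auto)

lemma mem_sub: "U \<subseteq> P \<Longrightarrow> (x, sub U) \<in> E \<longleftrightarrow> x \<in> c ` U"
  unfolding subset_code_def by (rule mem_set_code) (use sub_codes in auto)

lemma c_mem_sub: "U \<subseteq> P \<Longrightarrow> p \<in> P \<Longrightarrow> (c p, sub U) \<in> E \<longleftrightarrow> p \<in> U"
  using c_inj by (simp add: mem_sub inj_on_image_mem_iff)

lemma sub_subset_iff:
  assumes "U \<subseteq> P" "V \<subseteq> P"
  shows "(\<forall>p\<in>H. (p, sub U) \<in> E \<longrightarrow> (p, sub V) \<in> E) \<longleftrightarrow> U \<subseteq> V"
proof -
  have "(\<forall>p\<in>H. (p, sub U) \<in> E \<longrightarrow> (p, sub V) \<in> E) \<longleftrightarrow> c ` U \<subseteq> c ` V"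
    unfolding mem_sub[OF assms(1)] mem_sub[OF assms(2)] using sub_codes(1)[OF assms(1)] by blast
  also have "\<dots> \<longleftrightarrow> U \<subseteq> V"
    using assms c_inj inj_on_image_mem_iff[OF c_inj _ assms(2)] by blast
  finally show ?thesis .
qed

lemma sub_inject: "U \<subseteq> P \<Longrightarrow> V \<subseteq> P \<Longrightarrow> sub U = sub V \<longleftrightarrow> U = V"
  using sub_subset_iff by (metis subset_antisym)

lemma RO_subset: "U \<in> RO P le \<Longrightarrow> U \<subseteq> P"
  by (simp add: RO_iff)

text \<open>Quantifiers bounded by \<open>Pc\<close> and \<open>sub U\<close> turn into quantifiers
  over P and U, and the formula becomes \<open>RO_iff\<close>.\<close>

lemma is_RO_sub:
  assumes U: "U \<subseteq> P"
  shows "is_RO H E Pc Lc (sub U) \<longleftrightarrow> U \<in> RO P le"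
proof -
  have all: "(\<forall>x\<in>H. (x, Pc) \<in> E \<longrightarrow> Q x) \<longleftrightarrow> (\<forall>p\<in>P. Q (c p))" for Q
    using c_in_H by (auto simp: mem_Pc)
  have ex: "(\<exists>x\<in>H. (x, sub U) \<in> E \<and> Q x) \<longleftrightarrow> (\<exists>p\<in>U. Q (c p))" for Q
    using c_in_H U by (auto simp: mem_sub)
  have "maps_to H E Lc (c p) (c q) \<longleftrightarrow> (p, q) \<in> le" if "p \<in> U" "q \<in> P" for p q
    using that U by (auto simp: maps_to_Lc)
  moreover have "\<forall>x\<in>H. (x, sub U) \<in> E \<longrightarrow> (x, Pc) \<in> E"
    using U by (auto simp: mem_sub mem_Pc)
  ultimately show ?thesis
    unfolding is_RO_def all ex RO_iff using U by (simp add: c_mem_sub maps_to_Lc)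
qed

text \<open>All members of such a u are codes of points of P, so u can be pulled back along
  c.\<close>

lemma is_RO_iff:
  assumes u: "u \<in> H"
  shows "is_RO H E Pc Lc u \<longleftrightarrow> (\<exists>U\<in>RO P le. u = sub U)"
proof
  assume *: "is_RO H E Pc Lc u"
  define U where "U = {p \<in> P. (c p, u) \<in> E}"
  have U: "U \<subseteq> P" by (auto simp: U_def)
  have "(x, u) \<in> E \<longleftrightarrow> (x, sub U) \<in> E" for x
  proof -
    have "(x, u) \<in> E \<Longrightarrow> x \<in> c ` P" using * E_in_H(1)[of x u] by (simp add: is_RO_def mem_Pc)
    then show ?thesis unfolding mem_sub[OF U] by (auto simp: U_def)
  qed
  then have "u = sub U" by (rule extensionality[OF u sub_in_H[OF U]])
  moreover from this have "U \<in> RO P le" using * is_RO_sub[OF U] by simp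
  ultimately show "\<exists>U\<in>RO P le. u = sub U" by blast
qed (auto simp: is_RO_sub RO_subset)

lemma RO_small: "|RO P le| <o \<theta>"
  by (rule small_subset[OF Pow_small]) (auto simp: RO_iff)

lemma fam_codes:
  assumes "F \<subseteq> RO P le"
  shows "sub ` F \<subseteq> H" "|sub ` F| <o \<theta>"
proof -
  show "sub ` F \<subseteq> H" using assms sub_in_H RO_subset by auto
  show "|sub ` F| <o \<theta>" using assms by (intro small_image small_subset[OF RO_small])
qed

lemma fam_in_H: "F \<subseteq> RO P le \<Longrightarrow> fam F \<in> H"
  unfolding family_code_def by (rule set_code) (use fam_codes in auto)

lemma mem_fam: "F \<subseteq> RO P le \<Longrightarrow> (x, fam F) \<in> E \<longleftrightarrow> x \<in> sub ` F"
  unfolding family_code_def by (rule mem_set_code) (use fam_codes in auto)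

lemma sub_mem_fam: "F \<subseteq> RO P le \<Longrightarrow> U \<in> RO P le \<Longrightarrow> (sub U, fam F) \<in> E \<longleftrightarrow> U \<in> F"
  unfolding mem_fam image_iff by (metis RO_subset sub_inject subsetD)

lemma mem_sub_Int:
  assumes "U \<subseteq> P" "V \<subseteq> P"
  shows "(x, sub (U \<inter> V)) \<in> E \<longleftrightarrow> (x, sub U) \<in> E \<and> (x, sub V) \<in> E"
proof -
  have "U \<inter> V \<subseteq> P" using assms by auto
  then show ?thesis using inj_on_image_Int[OF c_inj assms] assms by (simp add: mem_sub)
qed

text \<open>The closure properties of \<open>large a\<close> carry over to codes. An empty
  \<open>large a\<close> is covered too, since the formula does not ask for a member.\<close>

lemma is_RO_filter_large: "is_RO_filter H E Pc Lc (fam (large a))"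
proof -
  have sub: "large a \<subseteq> RO P le" by (auto simp: large_def)
  have 1: "is_RO H E Pc Lc u \<and> (\<exists>p\<in>H. (p, u) \<in> E)" if u: "(u, fam (large a)) \<in> E" for u
  proof -
    obtain U where U: "U \<in> large a" "u = sub U" using u sub by (auto simp: mem_fam)
    then have "U \<in> RO P le" "U \<noteq> {}" using sub empty_not_large by auto
    then obtain p where "p \<in> U" "U \<subseteq> P" using RO_subset by auto
    then have "(c p, u) \<in> E" "c p \<in> H" using U(2) by (auto simp: mem_sub c_in_H)
    then show ?thesis using \<open>U \<in> RO P le\<close> \<open>U \<subseteq> P\<close> U(2) is_RO_sub by blast
  qed
  have 2: "(v, fam (large a)) \<in> E"
    if uv: "v \<in> H" "(u, fam (large a)) \<in> E" "is_RO H E Pc Lc v" "\<forall>p\<in>H. (p, u) \<in> E \<longrightarrow> (p, v) \<in> E"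
    for u v
  proof -
    obtain U where U: "U \<in> large a" "u = sub U" using uv(2) sub by (auto simp: mem_fam)
    obtain V where V: "V \<in> RO P le" "v = sub V" using uv(1,3) is_RO_iff by auto
    have "U \<subseteq> V" using uv(4) U V sub sub_subset_iff[of U V] RO_subset by auto
    then have "V \<in> large a" using U(1) V(1) large_mono by blast
    then show ?thesis using V sub sub_mem_fam by blast
  qed
  have 3: "(x, fam (large a)) \<in> E"
    if uv: "x \<in> H" "(u, fam (large a)) \<in> E" "(v, fam (large a)) \<in> E"
      "\<forall>p\<in>H. (p, x) \<in> E \<longleftrightarrow> (p, u) \<in> E \<and> (p, v) \<in> E" for u v x
  proof -
    obtain U where U: "U \<in> large a" "u = sub U" using uv(2) sub by (auto simp: mem_fam)
    obtain V where V: "V \<in> large a" "v = sub V" using uv(3) sub by (auto simp: mem_fam)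
    have P: "U \<subseteq> P" "V \<subseteq> P" using U V sub RO_subset by auto
    have "x = sub (U \<inter> V)"
    proof (rule extensionality)
      show "sub (U \<inter> V) \<in> H" using P by (intro sub_in_H) auto
    qed (simp_all add: uv(1,4) mem_sub_Int P U(2) V(2))
    then show ?thesis using large_Int[OF U(1) V(1)] sub by (auto simp: mem_fam)
  qed
  show ?thesis
    unfolding is_RO_filter_def
  proof (intro conjI ballI impI)
    fix u v assume "v \<in> H" "(u, fam (large a)) \<in> E" "is_RO H E Pc Lc v"
      "\<forall>p\<in>H. (p, u) \<in> E \<longrightarrow> (p, v) \<in> E"
    then show "(v, fam (large a)) \<in> E" by (rule 2)
  next
    fix u v x assume "x \<in> H" "(u, fam (large a)) \<in> E" "(v, fam (large a)) \<in> E"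
      "\<forall>p\<in>H. (p, x) \<in> E \<longleftrightarrow> (p, u) \<in> E \<and> (p, v) \<in> E"
    then show "(x, fam (large a)) \<in> E" by (rule 3)
  qed (use 1 in simp_all)
qed

lemma is_RO_filterD:
  assumes "is_RO_filter H E Pc Lc \<phi>"
  shows "(u, \<phi>) \<in> E \<Longrightarrow> is_RO H E Pc Lc u"
    and "(u, \<phi>) \<in> E \<Longrightarrow> \<exists>p. (p, u) \<in> E"
    and "(u, \<phi>) \<in> E \<Longrightarrow> v \<in> H \<Longrightarrow> is_RO H E Pc Lc v \<Longrightarrow>
      \<forall>p\<in>H. (p, u) \<in> E \<longrightarrow> (p, v) \<in> E \<Longrightarrow> (v, \<phi>) \<in> E"
    and "(u, \<phi>) \<in> E \<Longrightarrow> (v, \<phi>) \<in> E \<Longrightarrow> x \<in> H \<Longrightarrow>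
      \<forall>p\<in>H. (p, x) \<in> E \<longleftrightarrow> (p, u) \<in> E \<and> (p, v) \<in> E \<Longrightarrow> (x, \<phi>) \<in> E"
  using assms E_in_H(1)[of u \<phi>] E_in_H(1)[of v \<phi>] unfolding is_RO_filter_def by meson+

text \<open>The member u supplies the nonemptiness that the formula leaves open.\<close>

lemma is_RO_filter_decode:
  assumes \<phi>: "\<phi> \<in> H" "is_RO_filter H E Pc Lc \<phi>" and ne: "(u, \<phi>) \<in> E"
  obtains F where "RO_filter P le F" "\<phi> = fam F"
proof
  define F where "F = {U \<in> RO P le. (sub U, \<phi>) \<in> E}"
  have F: "F \<subseteq> RO P le" by (auto simp: F_def)
  have dec: "\<exists>U\<in>F. x = sub U" if x: "(x, \<phi>) \<in> E" for x
  proof -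
    obtain U where "U \<in> RO P le" "x = sub U"
      using is_RO_filterD(1)[OF \<phi>(2) x] is_RO_iff[OF E_in_H(1)[OF x]] by auto
    then show ?thesis using x by (auto simp: F_def)
  qed
  have "(x, \<phi>) \<in> E \<longleftrightarrow> (x, fam F) \<in> E" for x
  proof
    show "(x, \<phi>) \<in> E \<Longrightarrow> (x, fam F) \<in> E" unfolding mem_fam[OF F] image_iff by (rule dec)
    show "(x, fam F) \<in> E \<Longrightarrow> (x, \<phi>) \<in> E" unfolding mem_fam[OF F] by (auto simp: F_def)
  qed
  then show "\<phi> = fam F" by (rule extensionality[OF \<phi>(1) fam_in_H[OF F]])
  have "F \<noteq> {}" using dec[OF ne] by auto
  moreover have "{} \<notin> F"
  proof
    assume "{} \<in> F"
    then have "(sub {}, \<phi>) \<in> E" by (simp add: F_def)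
    from is_RO_filterD(2)[OF \<phi>(2) this] show False by (simp add: mem_sub)
  qed
  moreover have "V \<in> F" if UV: "U \<in> F" "V \<in> RO P le" "U \<subseteq> V" for U V
  proof -
    have P: "U \<subseteq> P" "V \<subseteq> P" using UV RO_subset by auto
    have "(sub V, \<phi>) \<in> E"
    proof (rule is_RO_filterD(3)[OF \<phi>(2)])
      show "(sub U, \<phi>) \<in> E" using UV(1) by (simp add: F_def)
      show "is_RO H E Pc Lc (sub V)" using UV(2) is_RO_sub[OF P(2)] by simp
      show "\<forall>p\<in>H. (p, sub U) \<in> E \<longrightarrow> (p, sub V) \<in> E" using UV(3) sub_subset_iff[OF P] by simp
    qed (rule sub_in_H[OF P(2)])
    then show ?thesis using UV(2) by (simp add: F_def)
  qed
  moreover have "U \<inter> V \<in> F" if UV: "U \<in> F" "V \<in> F" for U V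
  proof -
    have P: "U \<subseteq> P" "V \<subseteq> P" using UV F RO_subset by auto
    have "(sub (U \<inter> V), \<phi>) \<in> E"
    proof (rule is_RO_filterD(4)[OF \<phi>(2)])
      show "(sub U, \<phi>) \<in> E" "(sub V, \<phi>) \<in> E" using UV by (simp_all add: F_def)
      show "sub (U \<inter> V) \<in> H" using P by (intro sub_in_H) auto
    qed (simp add: mem_sub_Int[OF P])
    then show ?thesis using UV RO_Int by (simp add: F_def)
  qed
  ultimately show "RO_filter P le F" using F by (simp add: RO_filter_def)
qed

end

section \<open>Closed sets contain the required filters\<close>

context coded_poset
begin

text \<open>Regularity of \<theta> bounds a union of fewer than \<theta> finite sets.\<close>

lemma roots_small: "|roots| <o \<theta>"
proof -
  have "|\<Union>q\<in>P. Pow (w q)| <o \<theta>"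
    by (rule stable_UNION[OF stable_theta P_small]) (simp add: small_finite w_finite)
  then show ?thesis unfolding roots_def
    using card_of_Un_ordLess_infinite_Field[OF infinite_theta theta(1), of "{{}}"] small_finite
    by (metis finite.emptyI finite_insert insert_is_Un)
qed

text \<open>The constant k of the algebra codes the empty root. The roots coded in a closed D
  contain the empty set and are closed under the enumeration maps, so a maximal one below the weight
  of q gives the filter.\<close>

lemma Ycc_algebra_exists:
  "\<exists>k\<in>H. \<exists>f\<in>H. \<exists>g\<in>H. Ycc_algebra H E Pc Lc k f g"
proof -
  obtain j where j: "inj_on j roots" "j ` roots \<subseteq> H" using small_inj_into_H[OF roots_small] by blast
  have jH: "j k \<in> H" if "k \<in> roots" for k using j(2) that by auto
  \<comment> \<open>Packaging the property as one predicate allows \<open>h\<close> to be chosen for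
    all U and k simultaneously.\<close>
  define good where "good U k h \<longleftrightarrow> (\<forall>x. h x \<in> roots) \<and>
    (\<forall>S q. {} \<in> S \<longrightarrow> (\<forall>x\<in>S. h x \<in> S) \<longrightarrow> U \<in> RO P le \<longrightarrow> U \<notin> large k \<longrightarrow>
      q \<in> U \<longrightarrow> k \<subseteq> w q \<longrightarrow> (\<exists>x\<in>w q - k. insert x k \<in> S))" for U k h
  have "\<exists>h. good U k h" for U k
  proof -
    obtain h where "\<And>x. h x \<in> roots"
      "\<And>S q. {} \<in> S \<Longrightarrow> (\<And>x. x \<in> S \<Longrightarrow> h x \<in> S) \<Longrightarrow> U \<in> RO P le \<Longrightarrow> U \<notin> large k \<Longrightarrow>
        q \<in> U \<Longrightarrow> k \<subseteq> w q \<Longrightarrow> \<exists>x\<in>w q - k. insert x k \<in> S"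
      using root_extension[of U k] by metis
    then have "good U k h" by (simp add: good_def)
    then show ?thesis by blast
  qed
  then obtain h where good: "\<And>U k. good U k (h U k)" by metis
  have h_roots: "h U k x \<in> roots" for U k x using good[of U k] by (simp add: good_def)
  have h: "\<exists>x\<in>w q - k. insert x k \<in> S" if "{} \<in> S" "\<forall>x\<in>S. h U k x \<in> S" "U \<in> RO P le" "U \<notin> large k"
    "q \<in> U" "k \<subseteq> w q" for U k S q
    using good[of U k] that by (simp add: good_def)
  have large_RO: "large k \<subseteq> RO P le" for k by (auto simp: large_def)
  \<comment> \<open>The key records U, the current root k and the position x in the orbit; k and x
    enter through their codes under \<open>j\<close>.\<close>
  define key where "key U k x = pair (pair (sub U) (j k)) (j x)" for U k x
  define fs where "fs = (\<lambda>k. pair (j k) (fam (large k))) ` roots"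
  define gs where "gs = (\<lambda>(U, k, x). pair (key U k x) (j (h U k x))) ` (RO P le \<times> roots \<times> roots)"
  have keyH: "key U k x \<in> H" if "U \<in> RO P le" "k \<in> roots" "x \<in> roots" for U k x
    using that by (simp add: key_def pair_code_in_H sub_in_H RO_subset jH)
  have key_inj: "U = U' \<and> k = k' \<and> x = x'"
    if "key U k x = key U' k' x'" "U \<in> RO P le" "k \<in> roots" "x \<in> roots"
      "U' \<in> RO P le" "k' \<in> roots" "x' \<in> roots" for U k x U' k' x'
    using that j(1)
    by (simp add: key_def pair_code_inject pair_code_in_H sub_in_H RO_subset jH sub_inject inj_on_eq_iff)
  have fs: "fs \<subseteq> H" "|fs| <o \<theta>"
    unfolding fs_def using jH fam_in_H[OF large_RO]
    by (auto intro!: pair_code_in_H small_image roots_small)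
  have gs: "gs \<subseteq> H" "|gs| <o \<theta>"
    unfolding gs_def using keyH jH h_roots
    by (auto intro!: pair_code_in_H small_image small_Times roots_small RO_small)
  define f where "f = set_code H E fs"
  define g where "g = set_code H E gs"
  have f: "maps_to H E f x y \<longleftrightarrow> (\<exists>k\<in>roots. x = j k \<and> y = fam (large k))"
    if "x \<in> H" "y \<in> H" for x y
  proof -
    have "maps_to H E f x y \<longleftrightarrow> (\<exists>k\<in>roots. pair x y = pair (j k) (fam (large k)))"
      using that by (simp add: maps_to_iff f_def mem_set_code[OF fs]) (auto simp: fs_def)
    also have "\<dots> \<longleftrightarrow> (\<exists>k\<in>roots. x = j k \<and> y = fam (large k))"
      using that by (intro bex_cong refl) (simp add: pair_code_inject jH fam_in_H[OF large_RO])
    finally show ?thesis .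
  qed
  have g: "maps_to H E g x y \<longleftrightarrow>
      (\<exists>U\<in>RO P le. \<exists>k\<in>roots. \<exists>z\<in>roots. x = key U k z \<and> y = j (h U k z))"
    if "x \<in> H" "y \<in> H" for x y
  proof -
    have "maps_to H E g x y \<longleftrightarrow>
        (\<exists>U\<in>RO P le. \<exists>k\<in>roots. \<exists>z\<in>roots. pair x y = pair (key U k z) (j (h U k z)))"
      using that by (simp add: maps_to_iff g_def mem_set_code[OF gs]) (force simp: gs_def)
    also have "\<dots> \<longleftrightarrow> (\<exists>U\<in>RO P le. \<exists>k\<in>roots. \<exists>z\<in>roots. x = key U k z \<and> y = j (h U k z))"
      using that by (intro bex_cong refl) (simp add: pair_code_inject jH keyH h_roots)
    finally show ?thesis .
  qed
  have "is_function H E f"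
    unfolding is_function_def
  proof (intro ballI impI)
    fix x y z assume *: "x \<in> H" "y \<in> H" "z \<in> H" "maps_to H E f x y" "maps_to H E f x z"
    obtain k where k: "k \<in> roots" "x = j k" "y = fam (large k)" using * f by auto
    obtain k' where k': "k' \<in> roots" "x = j k'" "z = fam (large k')" using * f by auto
    have "k = k'" using k k' j(1) by (simp add: inj_on_eq_iff)
    then show "y = z" using k k' by simp
  qed
  moreover have "is_function H E g"
    unfolding is_function_def
  proof (intro ballI impI)
    fix x y z assume *: "x \<in> H" "y \<in> H" "z \<in> H" "maps_to H E g x y" "maps_to H E g x z"
    obtain U k t where k: "U \<in> RO P le" "k \<in> roots" "t \<in> roots" "x = key U k t" "y = j (h U k t)"
      using * g by auto
    obtain U' k' t' where k': "U' \<in> RO P le" "k' \<in> roots" "t' \<in> roots" "x = key U' k' t'"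
      "z = j (h U' k' t')" using * g by auto
    have "U = U' \<and> k = k' \<and> t = t'" using k k' by (intro key_inj) simp_all
    then show "y = z" using k k' by simp
  qed
  moreover have "\<exists>F\<in>H. (F, D) \<in> E \<and> is_RO_filter H E Pc Lc F \<and>
      (\<forall>U\<in>H. (U, D) \<in> E \<longrightarrow> is_RO H E Pc Lc U \<longrightarrow> (q, U) \<in> E \<longrightarrow> (U, F) \<in> E)"
    if D: "(j {}, D) \<in> E" "closed_pairs H E D" "closed_under H E f D" "closed_under H E g D"
      and q: "(q, Pc) \<in> E" for D q
  proof -
    obtain p where p: "p \<in> P" "q = c p" using q by (auto simp: mem_Pc)
    define S where "S = {k \<in> roots. (j k, D) \<in> E}"
    let ?C = "{k \<in> S. k \<subseteq> w p}"
    have fin: "finite ?C" by (rule finite_subset[of _ "Pow (w p)"]) (auto simp: w_finite[OF p(1)])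
    have empty: "{} \<in> S" using D(1) by (auto simp: S_def roots_def)
    then have "?C \<noteq> {}" by auto
    \<comment> \<open>A maximal element exists because \<open>w p\<close> has only finitely many
      subsets.\<close>
    from finite_has_maximal[OF fin this]
    obtain k where kC: "k \<in> ?C" and max: "\<forall>k'\<in>?C. k \<subseteq> k' \<longrightarrow> k = k'" by (rule bexE)
    have k: "k \<in> S" "k \<subseteq> w p" using kC by auto
    have kr: "k \<in> roots" "(j k, D) \<in> E" using k by (auto simp: S_def)
    let ?F = "fam (large k)"
    have FH: "?F \<in> H" by (rule fam_in_H[OF large_RO])
    have "maps_to H E f (j k) ?F" unfolding f[OF jH[OF kr(1)] FH] using kr(1) by auto
    then have FD: "(?F, D) \<in> E" using closed_underD[OF D(3) kr(2) FH] by simp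
    have "(u, ?F) \<in> E" if u: "(u, D) \<in> E" "is_RO H E Pc Lc u" "(q, u) \<in> E" for u
    proof -
      obtain U where U: "U \<in> RO P le" "u = sub U" using u is_RO_iff[OF E_in_H(1)[OF u(1)]] by auto
      have pU: "p \<in> U" using u(3) p U c_mem_sub[OF RO_subset[OF U(1)] p(1)] by simp
      have closed: "\<forall>x\<in>S. h U k x \<in> S"
      proof
        fix x assume x: "x \<in> S"
        then have xr: "x \<in> roots" "(j x, D) \<in> E" by (auto simp: S_def)
        \<comment> \<open>All three components of the key have codes in D, so closure under pairs
          and then under g applies.\<close>
        have "(key U k x, D) \<in> E" 
          unfolding key_def using u(1) kr(2) xr(2) by (intro closed_pairsD[OF D(2)]) (simp_all add: U(2))
        moreover have "maps_to H E g (key U k x) (j (h U k x))"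
          unfolding g[OF keyH[OF U(1) kr(1) xr(1)] jH[OF h_roots]] using U(1) kr(1) xr(1) by auto
        ultimately have "(j (h U k x), D) \<in> E"
          by (rule closed_underD[OF D(4) _ jH[OF h_roots]])
        then show "h U k x \<in> S" using h_roots by (simp add: S_def)
      qed
      have "U \<in> large k"
      proof (rule ccontr)
        \<comment> \<open>The enumeration then reaches a one-point extension of k inside
          \<open>w p\<close> whose code is in D, against maximality.\<close>
        assume "U \<notin> large k"
        then obtain x where x: "x \<in> w p - k" "insert x k \<in> S"
          using h[OF empty closed U(1) _ pU k(2)] by auto
        then have "insert x k \<in> ?C" using k(2) by auto
        then have "k = insert x k" using max by blast
        then show False using x(1) by auto
      qed
      then show ?thesis using U sub_mem_fam[OF large_RO U(1)] by simp
    qed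
    then show ?thesis using FH FD is_RO_filter_large by blast
  qed
  ultimately have "Ycc_algebra H E Pc Lc (j {}) f g" unfolding Ycc_algebra_def by simp
  moreover have "j {} \<in> H" using jH by (simp add: roots_def)
  moreover have "f \<in> H" unfolding f_def by (rule set_code[OF fs])
  moreover have "g \<in> H" unfolding g_def by (rule set_code[OF gs])
  ultimately show ?thesis by blast
qed

lemma poset_code_eq: "poset_code H E c P le = pair Pc Lc"
  by (simp add: poset_code_def Pc_def Lc_def)

section \<open>Countable elementary submodels\<close>

context
  fixes M assumes M: "elementary_submodel M H E"
begin

lemma M_in_H: "x \<in> M \<Longrightarrow> x \<in> H"
  using M by (auto simp: elementary_submodel_def)

text \<open>The pair is the only solution in H of a formula with parameters x and y, so elementarity
  finds it in M.\<close>

lemma pair_in_M: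
  assumes "x \<in> M" "y \<in> M" shows "pair x y \<in> M"
proof -
  let ?v = "(\<lambda>_. x)(1 := y)"
  have H: "x \<in> H" "y \<in> H" using assms M_in_H by auto
  have "sat H E ?v (FEx 2 (pair_fm 2 0 1))"
    using H pair_code_in_H[OF H] is_pair_iff[OF H pair_code_in_H[OF H]] by auto
  moreover have "range ?v \<subseteq> M" using assms by auto
  ultimately obtain z where "z \<in> M" "sat H E (?v(2 := z)) (pair_fm 2 0 1)"
    using elementary_submodel_witness[OF M] by blast
  then show ?thesis using is_pair_iff[OF H M_in_H] by simp
qed

text \<open>Elementarity yields some value in M, and single-valuedness identifies it with y.\<close>

lemma function_value_in_M:
  assumes "f \<in> M" "x \<in> M" "is_function H E f" "y \<in> H" "maps_to H E f x y"
  shows "y \<in> M"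
proof -
  let ?v = "(\<lambda>_. f)(1 := x)"
  have "sat H E ?v (FEx 2 (maps_to_fm 0 1 2))" using assms by auto
  moreover have "range ?v \<subseteq> M" using assms by auto
  ultimately obtain z where z: "z \<in> M" "sat H E (?v(2 := z)) (maps_to_fm 0 1 2)"
    using elementary_submodel_witness[OF M] by blast
  then have "maps_to H E f x z" by simp
  then have "y = z" using assms z(1) M_in_H unfolding is_function_def by blast
  then show ?thesis using z(1) by simp
qed

text \<open>M contains components of the pair, and injectivity of pairing shows that they are x and
  y.\<close>

lemma pair_components_in_M:
  assumes "pair x y \<in> M" "x \<in> H" "y \<in> H" shows "x \<in> M" "y \<in> M"
proof -
  let ?v = "\<lambda>_::nat. pair x y"
  have is_pair: "is_pair H E (pair x y) x y" using assms is_pair_iff M_in_H by simp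
  then have "sat H E ?v (FEx 1 (FEx 2 (pair_fm 0 1 2)))" using assms by auto
  then obtain a where a: "a \<in> M" "sat H E (?v(1 := a)) (FEx 2 (pair_fm 0 1 2))"
    by (rule elementary_submodel_witness[OF M, rotated]) (use assms in auto)
  from a(2) obtain b where b: "b \<in> M" "sat H E (?v(1 := a, 2 := b)) (pair_fm 0 1 2)"
    by (rule elementary_submodel_witness[OF M, rotated]) (use assms a in auto)
  have "pair x y = pair a b" using b is_pair_iff[OF M_in_H[OF a(1)] M_in_H[OF b(1)]] assms M_in_H by simp
  then have "x = a" "y = b" using assms a(1) b(1) M_in_H by (simp_all add: pair_code_inject)
  then show "x \<in> M" "y \<in> M" using a b by simp_all
qed

text \<open>The existence sentence has only \<open>Pc\<close> and \<open>Lc\<close> as parameters,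
  so its three witnesses can be taken in M one after another.\<close>

lemma Ycc_algebra_in_M:
  assumes "Pc \<in> M" "Lc \<in> M"
  obtains k f g where "k \<in> M" "f \<in> M" "g \<in> M" "Ycc_algebra H E Pc Lc k f g"
proof -
  let ?v = "(\<lambda>_::nat. Pc)(1 := Lc)"
  let ?\<phi> = "Ycc_algebra_fm 0 1 2 3 4"
  have "sat H E ?v (FEx 2 (FEx 3 (FEx 4 ?\<phi>)))" using Ycc_algebra_exists by simp
  then obtain k where k: "k \<in> M" "sat H E (?v(2 := k)) (FEx 3 (FEx 4 ?\<phi>))"
    by (rule elementary_submodel_witness[OF M, rotated]) (use assms in auto)
  from k(2) obtain f where f: "f \<in> M" "sat H E (?v(2 := k, 3 := f)) (FEx 4 ?\<phi>)"
    by (rule elementary_submodel_witness[OF M, rotated]) (use assms k in auto)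
  from f(2) obtain g where g: "g \<in> M" "sat H E (?v(2 := k, 3 := f, 4 := g)) ?\<phi>"
    by (rule elementary_submodel_witness[OF M, rotated]) (use assms k f in auto)
  from g(2) have "Ycc_algebra H E Pc Lc k f g" by simp
  then show ?thesis using that k(1) f(1) g(1) by blast
qed

text \<open>M is closed under pairing and under the functions f and g belonging to it, so the
  algebra property can be applied with the set M itself as D.\<close>

lemma Ycc_filter:
  assumes "countable M" "poset_code H E c P le \<in> M" and q: "q \<in> P"
  shows "\<exists>F. RO_filter P le F \<and> fam F \<in> M \<and>
    {U \<in> RO P le. sub U \<in> M \<and> RO_embed P le q \<subseteq> U} \<subseteq> F"
proof -
  have PL: "Pc \<in> M" "Lc \<in> M"
    using pair_components_in_M assms(2) Pc_in_H Lc_in_H unfolding poset_code_eq by blast+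
  obtain k f g where kfg: "k \<in> M" "f \<in> M" "g \<in> M" and alg: "Ycc_algebra H E Pc Lc k f g"
    using Ycc_algebra_in_M[OF PL] .
  \<comment> \<open>Being countable, M is small and hence coded by an element of H.\<close>
  define D where "D = set_code H E M"
  have MH: "M \<subseteq> H" "|M| <o \<theta>" using M_in_H small_countable assms(1) by auto
  have D: "D \<in> H" unfolding D_def by (rule set_code[OF MH])
  have mem_D: "(x, D) \<in> E \<longleftrightarrow> x \<in> M" for x unfolding D_def by (rule mem_set_code[OF MH])
  have fn: "is_function H E f" "is_function H E g" using alg by (simp_all add: Ycc_algebra_def)
  have closed: "closed_pairs H E D"
    unfolding closed_pairs_def mem_D using is_pair_iff pair_in_M by simp
  have closed_f: "closed_under H E f D"
    unfolding closed_under_def mem_D using function_value_in_M[OF kfg(2) _ fn(1)] by simp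
  have closed_g: "closed_under H E g D"
    unfolding closed_under_def mem_D using function_value_in_M[OF kfg(3) _ fn(2)] by simp
  have cq: "c q \<in> H" "(c q, Pc) \<in> E" using q c_in_H by (auto simp: mem_Pc)
  have kD: "(k, D) \<in> E" using kfg(1) by (simp add: mem_D)
  from alg[unfolded Ycc_algebra_def, THEN conjunct2, THEN conjunct2, rule_format,
      OF D kD closed closed_f closed_g cq]
  obtain \<phi> where \<phi>: "\<phi> \<in> H" "\<phi> \<in> M" "is_RO_filter H E Pc Lc \<phi>"
    and trace: "\<forall>u\<in>H. u \<in> M \<longrightarrow> is_RO H E Pc Lc u \<longrightarrow> (c q, u) \<in> E \<longrightarrow> (u, \<phi>) \<in> E"
    unfolding mem_D by (elim bexE conjE)
  have trace': "(sub U, \<phi>) \<in> E" if "U \<in> RO P le" "sub U \<in> M" "q \<in> U" for U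
    using that trace M_in_H RO_subset[OF that(1)] q by (simp add: is_RO_sub c_mem_sub)
  \<comment> \<open>The whole poset is a regular open set coded in M and containing q. It belongs to
    the filter, which is therefore nonempty.\<close>
  have "sub P = Pc" by (simp add: subset_code_def Pc_def)
  then have "(sub P, \<phi>) \<in> E" using trace'[OF carrier_RO] PL(1) q by simp
  then obtain F where F: "RO_filter P le F" "\<phi> = fam F" 
    by (rule is_RO_filter_decode[OF \<phi>(1,3)])
  have "U \<in> F" if "U \<in> RO P le" "sub U \<in> M" "RO_embed P le q \<subseteq> U" for U
  proof -
    have "F \<subseteq> RO P le" using F(1) by (simp add: RO_filter_def)
    \<comment> \<open>Since q lies in its own image under \<open>RO_embed\<close>, every U above
      that image contains q.\<close>
    moreover have "(sub U, fam F) \<in> E" using trace' that RO_embed_self[OF q] F(2) by auto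
    ultimately show ?thesis using sub_mem_fam that(1) by simp
  qed
  then have "{U \<in> RO P le. sub U \<in> M \<and> RO_embed P le q \<subseteq> U} \<subseteq> F" by auto
  then show ?thesis using F \<phi>(2) by auto
qed

end

end

theorem theorem3p1:
  fixes P :: "'a set" and le :: "'a rel" and w :: "'a \<Rightarrow> 'b set"
  assumes poset: "partial_order_on P le"
    and w_finite: "\<And>p. p \<in> P \<Longrightarrow> finite (w p)"
    and w_union: "\<And>p q. p \<in> P \<Longrightarrow> q \<in> P \<Longrightarrow> compatible P le p q \<Longrightarrow>
           \<exists>r\<in>P. (r, p) \<in> le \<and> (r, q) \<in> le \<and> w r = w p \<union> w q"
    and w_delta: "\<And>(p :: nat set \<Rightarrow> 'a) (q :: nat set \<Rightarrow> 'a) (a :: 'b set).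
           p ` omega1 \<subseteq> P \<Longrightarrow> q ` omega1 \<subseteq> P \<Longrightarrow>
           delta_system omega1 (\<lambda>\<alpha>. w (p \<alpha>)) a \<Longrightarrow>
           delta_system omega1 (\<lambda>\<alpha>. w (q \<alpha>)) a \<Longrightarrow>
           \<exists>\<alpha>\<in>omega1. \<exists>\<beta>\<in>omega1. compatible P le (p \<alpha>) (q \<beta>)"
  shows "Ycc TYPE('h) P le"
  unfolding Ycc_def
proof (intro allI impI, elim conjE)
  fix \<theta> :: "'h rel" and H E c M q
  assume *: "large_regular \<theta> P" "is_H_theta \<theta> H E" "inj_on c P" "c ` P \<subseteq> H"
    and M: "countable M" "elementary_submodel M H E" "poset_code H E c P le \<in> M" "q \<in> P"
  \<comment> \<open>Largeness puts \<theta> above \<omega>_1, hence above \<omega>, as the coding in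
    H requires.\<close>
  have "natLeq <o \<theta>"
    using * cardSuc_greater[OF natLeq_Card_order] ordLess_transitive
    unfolding large_regular_def by blast
  then interpret coded_poset P le w \<theta> H E c
    using assms * unfolding large_regular_def by unfold_locales auto
  show "\<exists>F. RO_filter P le F \<and> family_code H E c F \<in> M \<and>
    {U \<in> RO P le. subset_code H E c U \<in> M \<and> RO_embed P le q \<subseteq> U} \<subseteq> F"
    using Ycc_filter[OF M(2,1,3,4)] .
qed

end
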